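(* There exists a universal constant $C>0$ such that for every integer $d\ge 2$ and every $n\ge 2$ of the form $n=n_1^d$ with $n_1\in\mathbb{N}$, \[ \sup_{\theta_0\in\mathcal{M}(\mathbb{L}_{d,n})\cap B_\infty(1)} R(\hat\theta_n,\theta_0)\le C n^{-1/d}\log^4 n . \]
   Context: For $n=n_1^d$, $\mathbb{L}_{d,n}:=\{1,\ldots,n_1\}^d$, partially ordered by $u\preceq v$ iff $u_j\le v_j$ for all $j=1,\ldots,d$. $\mathcal{M}(\mathbb{L}_{d,n}):=\{\theta\in\mathbb{R}^{\mathbb{L}_{d,n}}:\theta_u\le\theta_v\text{ whenever }u\preceq v\}$ is the closed convex cone of isotonic vectors. $B_\infty(1)$ is the set of vectors with all entries of absolute value at most $1$. One observes $Y=(Y_w)_{w\in\mathbb{L}_{d,n}}$ with $Y_w=(\theta_0)_w+\epsilon_w$, where the $\epsilon_w$ are independent $N(0,1)$. The least squares estimator $\hat\theta_n$ is the Euclidean projection of $Y$ onto $\mathcal{M}(\mathbb{L}_{d,n})$, i.e. $\hat\theta_n=\arg\min_{\theta\in\mathcal{M}(\mathbb{L}_{d,n})}\|Y-\theta\|_2^2$. The risk is $R(\hat\theta_n,\theta_0):=\mathbb{E}\bigl[\frac1n\|\hat\theta_n-\theta_0\|_2^2\bigr]$, expectation under signal $\theta_0$. "Universal" means not depending on $d$, $n$ or anything else. *)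

theory Defs
  imports "HOL-Probability.Probability"
begin

text \<open>Lattice points are extensional functions on \<open>{1..d}\<close>, so that there are exactly
  \<open>m ^ d\<close> of them.\<close>

definition lattice_cube :: "nat \<Rightarrow> nat \<Rightarrow> (nat \<Rightarrow> nat) set" where
  "lattice_cube d m = {1..d} \<rightarrow>\<^sub>E {1..m}"

definition coord_le :: "nat \<Rightarrow> (nat \<Rightarrow> nat) \<Rightarrow> (nat \<Rightarrow> nat) \<Rightarrow> bool" where
  "coord_le d u v \<longleftrightarrow> (\<forall>j\<in>{1..d}. u j \<le> v j)"

text \<open>Real vectors indexed by the lattice are likewise extensional functions on it; this makes the
  minimiser in \<open>lse\<close> below unique.\<close>

definition isotonic_cone :: "nat \<Rightarrow> nat \<Rightarrow> ((nat \<Rightarrow> nat) \<Rightarrow> real) set" where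
  "isotonic_cone d m =
    {\<theta> \<in> extensional (lattice_cube d m).
      \<forall>u\<in>lattice_cube d m. \<forall>v\<in>lattice_cube d m. coord_le d u v \<longrightarrow> \<theta> u \<le> \<theta> v}"

definition sup_norm_unit_ball :: "nat \<Rightarrow> nat \<Rightarrow> ((nat \<Rightarrow> nat) \<Rightarrow> real) set" where
  "sup_norm_unit_ball d m =
    {\<theta> \<in> extensional (lattice_cube d m). \<forall>w\<in>lattice_cube d m. \<bar>\<theta> w\<bar> \<le> 1}"

definition sq_dist :: "nat \<Rightarrow> nat \<Rightarrow> ((nat \<Rightarrow> nat) \<Rightarrow> real) \<Rightarrow> ((nat \<Rightarrow> nat) \<Rightarrow> real) \<Rightarrow> real" where
  "sq_dist d m x y = (\<Sum>w\<in>lattice_cube d m. (x w - y w)\<^sup>2)"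

definition lse :: "nat \<Rightarrow> nat \<Rightarrow> ((nat \<Rightarrow> nat) \<Rightarrow> real) \<Rightarrow> ((nat \<Rightarrow> nat) \<Rightarrow> real)" where
  "lse d m Y = arg_min_on (\<lambda>\<theta>. sq_dist d m Y \<theta>) (isotonic_cone d m)"

definition noise :: "nat \<Rightarrow> nat \<Rightarrow> ((nat \<Rightarrow> nat) \<Rightarrow> real) measure" where
  "noise d m = PiM (lattice_cube d m) (\<lambda>_. density lborel (\<lambda>x. ennreal (std_normal_density x)))"

text \<open>The expectation is a Lebesgue integral with values in \<open>[0, \<infinity>]\<close>, so that a finite bound on the
  risk includes its finiteness (a Bochner integral would default to 0).\<close>

definition risk ::
  "nat \<Rightarrow> nat \<Rightarrow> (((nat \<Rightarrow> nat) \<Rightarrow> real) \<Rightarrow> ((nat \<Rightarrow> nat) \<Rightarrow> real)) \<Rightarrow> ((nat \<Rightarrow> nat) \<Rightarrow> real) \<Rightarrow> ennreal" where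
  "risk d m est \<theta>\<^sub>0 =
    (\<integral>\<^sup>+ \<epsilon>. ennreal (1 / real (m ^ d)
       * sq_dist d m (est (\<lambda>w\<in>lattice_cube d m. \<theta>\<^sub>0 w + \<epsilon> w)) \<theta>\<^sub>0) \<partial>noise d m)"

end

theory Submission
  imports Defs
begin

text \<open>
  The loss is controlled by the Gaussian complexity of bounded monotone functions, without any
  localisation: the rate \<open>n powr (- 1 / d) = 1 / m\<close> is already reached by the complexity of the
  whole bounded cone.

  Let \<open>\<mu>\<close> be the largest absolute value of the noise. Truncating an isotonic vector at the
  extremes of the data keeps it isotonic, and moves it closer to the data if it changes it at all, so the estimator has
  entries of absolute value at most \<open>1 + \<mu>\<close> (\<open>lse_minimises_and_bounded\<close>). As the estimator is
  at least as close to the data as \<open>\<theta>\<^sub>0\<close>, its squared distance from \<open>\<theta>\<^sub>0\<close> is at most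
  twice its inner product, minus that of \<open>\<theta>\<^sub>0\<close>, with the noise
  (\<open>sq_dist_le_of_closer_to_observation\<close>). Both inner products are split along the
  \<open>m ^ (d - 2)\<close> two-dimensional slices of the cube on which all coordinates but the first two are
  constant; on each slice the vectors remain monotone. This is why no constant depends on \<open>d\<close>.

  On a slice, padded to a square of side \<open>2 ^ K\<close> with \<open>m \<le> 2 ^ K \<le> 2 * m\<close>, a monotone function
  bounded by \<open>B\<close> is the constant \<open>- B\<close> plus an integral of indicators of upper sets over the
  levels from \<open>- B\<close> to \<open>B\<close>, so its inner product with the noise is at most \<open>3 * B\<close> times the largest noise sum over an upper set
  (\<open>abs_weighted_sum_le_of_superlevel_sums\<close>). Upper sets are chained dyadically. An upper set of
  a square of side \<open>2 * q\<close> consists of the two-by-two cells that it contains, which form an upper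
  set of the square of side \<open>q\<close>, and of a fringe. On every diagonal the fringe has at most two
  points, hence it has only \<open>O(q)\<close> points altogether (\<open>card_fringe_le\<close>), while the number of upper
  sets has logarithm \<open>O(q * ln q)\<close>. After \<open>k\<close> coarsenings each point carries variance \<open>4 ^ k\<close> and
  \<open>q\<close> is of order \<open>2 ^ (K - k)\<close>, so the product of variance and entropy is, up to a factor of
  order \<open>K - k\<close>, the same \<open>4 ^ K\<close> at every scale. Summing the square roots over the scales bounds
  the maximal noise sum on a slice by \<open>O(2 ^ K * K\<^sup>2)\<close>.

  The estimator's bound \<open>1 + \<mu>\<close> depends on the same noise. This factor is carried through
  the chaining by the Cauchy-Schwarz inequality (\<open>nn_integral_mult_chain_bound_le\<close>) and
  contributes the root of its second moment, which is at most of order \<open>ln n\<close>. Since \<open>K\<close> is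
  \<open>O(ln n)\<close> as well, the risk is \<open>O(m ^ (d - 2) * ln n * 2 ^ K * K\<^sup>2 / m ^ d)\<close>, which is
  \<open>O((ln n) ^ 3 / m)\<close>.
\<close>

section \<open>Second moments of maxima\<close>

lemma nn_integral_mult_le_of_second_moments:
  assumes [measurable]: "A \<in> borel_measurable M" "B \<in> borel_measurable M"
    and nonneg: "\<And>x. 0 \<le> A x" "\<And>x. 0 \<le> B x" "0 \<le> \<alpha>" "0 \<le> \<beta>"
    and A2: "(\<integral>\<^sup>+x. ennreal ((A x)\<^sup>2) \<partial>M) \<le> ennreal (\<alpha>\<^sup>2)"
    and B2: "(\<integral>\<^sup>+x. ennreal ((B x)\<^sup>2) \<partial>M) \<le> ennreal (\<beta>\<^sup>2)"
  shows "(\<integral>\<^sup>+x. ennreal (A x * B x) \<partial>M) \<le> ennreal (\<alpha> * \<beta>)"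
proof -
  have "(\<integral>\<^sup>+x. ennreal (A x * B x) \<partial>M)\<^sup>2 = (\<integral>\<^sup>+x. ennreal (A x) * ennreal (B x) \<partial>M)\<^sup>2"
    by (simp add: ennreal_mult nonneg)
  also have "\<dots> \<le> (\<integral>\<^sup>+x. ennreal (A x) ^ 2 \<partial>M) * (\<integral>\<^sup>+x. ennreal (B x) ^ 2 \<partial>M)"
    by (rule Cauchy_Schwarz_nn_integral) auto
  also have "\<dots> \<le> ennreal (\<alpha>\<^sup>2) * ennreal (\<beta>\<^sup>2)"
    using A2 B2 by (intro mult_mono) (auto simp: ennreal_power nonneg)
  also have "\<dots> = (ennreal (\<alpha> * \<beta>))\<^sup>2"
    by (simp add: ennreal_power nonneg power_mult_distrib ennreal_mult)
  finally have sq: "(\<integral>\<^sup>+x. ennreal (A x * B x) \<partial>M)\<^sup>2 \<le> (ennreal (\<alpha> * \<beta>))\<^sup>2" .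
  show ?thesis
  proof (cases "\<integral>\<^sup>+x. ennreal (A x * B x) \<partial>M")
    case (real r)
    then have "r\<^sup>2 \<le> (\<alpha> * \<beta>)\<^sup>2" using sq nonneg by (simp add: ennreal_power)
    then show ?thesis using real nonneg by (auto intro!: ennreal_leI dest: power2_le_imp_le)
  next
    case top
    then show ?thesis using sq by (simp add: power2_eq_square top_unique ennreal_mult_eq_top_iff)
  qed
qed

text \<open>Trades a square for a single exponential moment: below the threshold \<open>L\<close> the first summand
  suffices, and the excess over \<open>L\<close> is paid for by the exponential. In the maximal inequality
  below this allows a union bound at one fixed exponent.\<close>

lemma square_le_of_exp:
  fixes L x :: real
  assumes "1 \<le> L" "0 \<le> x"
  shows "x\<^sup>2 \<le> 2 * L\<^sup>2 + 4 * exp (L * x - L\<^sup>2)"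
proof (cases "x \<le> L")
  case True
  then have "x\<^sup>2 \<le> L\<^sup>2" using assms by (intro power_mono) auto
  then show ?thesis by (smt (verit) exp_gt_zero zero_le_power2)
next
  case False
  define t where "t = x - L"
  have t: "0 < t" "x = L + t" using False by (auto simp: t_def)
  have "x\<^sup>2 \<le> 2 * L\<^sup>2 + 2 * t\<^sup>2"
    using zero_le_power2[of "L - t"] by (simp add: t power2_eq_square algebra_simps)
  moreover have "t\<^sup>2 \<le> 2 * exp t"
    using exp_lower_Taylor_quadratic[of t] t by simp
  moreover have "exp t \<le> exp (L * x - L\<^sup>2)"
    using assms t by (simp add: power2_eq_square algebra_simps)
  ultimately show ?thesis by linarith
qed

text \<open>A maximum of exponentials is at most their sum, so the family enters through
  \<open>2 * card I\<close> exponential moments (one for each sign); the threshold \<open>L\<close> of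
  \<open>square_le_of_exp\<close> is chosen to absorb exactly this number.\<close>

lemma (in prob_space) second_moment_Max_le:
  fixes Z :: "'i \<Rightarrow> 'a \<Rightarrow> real"
  assumes I: "finite I" "I \<noteq> {}" and v: "0 < v"
    and Z[measurable]: "\<And>i. i \<in> I \<Longrightarrow> Z i \<in> borel_measurable M"
    and mgf: "\<And>i l. i \<in> I \<Longrightarrow> (\<integral>\<^sup>+x. ennreal (exp (l * Z i x)) \<partial>M) \<le> ennreal (exp (l\<^sup>2 * v / 2))"
  shows "(\<integral>\<^sup>+x. ennreal ((Max ((\<lambda>i. \<bar>Z i x\<bar>) ` I))\<^sup>2) \<partial>M)
           \<le> ennreal (v * (4 * ln (2 * real (card I)) + 4))"
proof -
  define N where "N = real (card I)"
  have N: "1 \<le> N" using I by (simp add: N_def Suc_le_eq card_gt_0_iff)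
  \<comment> \<open>With this threshold the total exponential contribution is the constant \<open>4 * v\<close>.\<close>
  define L where "L = sqrt (2 * ln (2 * N))"
  have ln2: "1/2 \<le> ln (2::real)" by (rule order.trans[OF _ ln2_ge_two_thirds]) simp
  have "ln 2 \<le> ln (2 * N)" using N by (intro ln_mono) auto
  then have lnN: "1/2 \<le> ln (2 * N)" using ln2 by linarith
  have L2: "L\<^sup>2 = 2 * ln (2 * N)" using lnN by (simp add: L_def)
  have L1: "1 \<le> L" using lnN by (simp add: L_def)
  define l where "l = L / sqrt v"
  have l2: "l\<^sup>2 * v = L\<^sup>2" using v by (simp add: l_def power_divide)
  have pw: "(Max ((\<lambda>i. \<bar>Z i x\<bar>) ` I))\<^sup>2
      \<le> v * (2 * L\<^sup>2) + (\<Sum>i\<in>I. v * 4 * exp (- L\<^sup>2) * (exp (l * Z i x) + exp (- l * Z i x)))" for x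
  proof -
    have "Max ((\<lambda>i. \<bar>Z i x\<bar>) ` I) \<in> (\<lambda>i. \<bar>Z i x\<bar>) ` I" using I by (intro Max_in) auto
    then obtain i where i: "i \<in> I" "Max ((\<lambda>i. \<bar>Z i x\<bar>) ` I) = \<bar>Z i x\<bar>" by auto
    have "(\<bar>Z i x\<bar> / sqrt v)\<^sup>2 \<le> 2 * L\<^sup>2 + 4 * exp (L * (\<bar>Z i x\<bar> / sqrt v) - L\<^sup>2)"
      by (rule square_le_of_exp[OF L1]) (use v in auto)
    also have "L * (\<bar>Z i x\<bar> / sqrt v) - L\<^sup>2 = - L\<^sup>2 + l * \<bar>Z i x\<bar>" by (simp add: l_def)
    also have "exp (- L\<^sup>2 + l * \<bar>Z i x\<bar>) = exp (- L\<^sup>2) * exp (l * \<bar>Z i x\<bar>)" by (rule exp_add)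
    also have "exp (l * \<bar>Z i x\<bar>) \<le> exp (l * Z i x) + exp (- l * Z i x)"
      by (cases "0 \<le> Z i x") auto
    also have "(\<bar>Z i x\<bar> / sqrt v)\<^sup>2 = (Z i x)\<^sup>2 / v" using v by (simp add: power_divide)
    finally have "(Z i x)\<^sup>2 \<le> v * (2 * L\<^sup>2 + 4 * (exp (- L\<^sup>2) * (exp (l * Z i x) + exp (- l * Z i x))))"
      using v by (simp add: divide_simps mult.commute)
    also have "\<dots> = v * (2 * L\<^sup>2) + v * 4 * exp (- L\<^sup>2) * (exp (l * Z i x) + exp (- l * Z i x))"
      by (simp add: algebra_simps)
    also have "\<dots> \<le> v * (2 * L\<^sup>2) + (\<Sum>i\<in>I. v * 4 * exp (- L\<^sup>2) * (exp (l * Z i x) + exp (- l * Z i x)))"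
      using i(1) I v by (intro add_left_mono member_le_sum) (auto intro!: mult_nonneg_nonneg add_nonneg_nonneg)
    finally show ?thesis by (simp add: i)
  qed
  have one: "(\<integral>\<^sup>+x. ennreal (v * 4 * exp (- L\<^sup>2) * (exp (l * Z i x) + exp (- l * Z i x))) \<partial>M)
      \<le> ennreal (v * 4 / N)" if i: "i \<in> I" for i
  proof -
    note [measurable] = Z[OF i]
    have "(\<integral>\<^sup>+x. ennreal (v * 4 * exp (- L\<^sup>2) * (exp (l * Z i x) + exp (- l * Z i x))) \<partial>M)
       = ennreal (v * 4 * exp (- L\<^sup>2)) * ((\<integral>\<^sup>+x. ennreal (exp (l * Z i x)) \<partial>M)
            + (\<integral>\<^sup>+x. ennreal (exp (- l * Z i x)) \<partial>M))"
      using v by (subst nn_integral_add[symmetric], measurable, subst nn_integral_cmult[symmetric])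
         (auto simp: ennreal_mult ennreal_plus intro!: nn_integral_cong)
    also have "\<dots> \<le> ennreal (v * 4 * exp (- L\<^sup>2)) * (ennreal (exp (L\<^sup>2 / 2)) + ennreal (exp (L\<^sup>2 / 2)))"
      using mgf[OF i, of l] mgf[OF i, of "- l"] by (intro mult_left_mono add_mono) (auto simp: l2)
    also have "\<dots> = ennreal (v * 4 * exp (- L\<^sup>2) * (2 * exp (L\<^sup>2 / 2)))"
      using v by (subst ennreal_plus[symmetric], simp, simp, subst ennreal_mult[symmetric]) auto
    also have "v * 4 * exp (- L\<^sup>2) * (2 * exp (L\<^sup>2 / 2)) = v * 4 * 2 * exp (- (L\<^sup>2 / 2))"
      by (simp add: exp_minus field_simps flip: exp_add)
    also have "exp (- (L\<^sup>2 / 2)) = 1 / (2 * N)" using N by (simp add: L2 exp_minus divide_simps)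
    finally show ?thesis using N by (simp add: mult_ac)
  qed
  have "(\<integral>\<^sup>+x. ennreal ((Max ((\<lambda>i. \<bar>Z i x\<bar>) ` I))\<^sup>2) \<partial>M)
     \<le> (\<integral>\<^sup>+x. ennreal (v * (2 * L\<^sup>2)) +
          (\<Sum>i\<in>I. ennreal (v * 4 * exp (- L\<^sup>2) * (exp (l * Z i x) + exp (- l * Z i x)))) \<partial>M)"
  proof (rule nn_integral_mono)
    fix x
    have n: "0 \<le> v * 4 * exp (- L\<^sup>2) * (exp (l * Z i x) + exp (- l * Z i x))" for i
      using v by (auto intro!: mult_nonneg_nonneg add_nonneg_nonneg)
    show "ennreal ((Max ((\<lambda>i. \<bar>Z i x\<bar>) ` I))\<^sup>2) \<le> ennreal (v * (2 * L\<^sup>2)) +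
          (\<Sum>i\<in>I. ennreal (v * 4 * exp (- L\<^sup>2) * (exp (l * Z i x) + exp (- l * Z i x))))"
      using v n pw[of x] by (subst sum_ennreal, simp, subst ennreal_plus[symmetric])
        (auto intro!: sum_nonneg ennreal_leI)
  qed
  also have "\<dots> = ennreal (v * (2 * L\<^sup>2)) +
      (\<Sum>i\<in>I. \<integral>\<^sup>+x. ennreal (v * 4 * exp (- L\<^sup>2) * (exp (l * Z i x) + exp (- l * Z i x))) \<partial>M)"
    by (subst nn_integral_add) (auto simp: nn_integral_sum emeasure_space_1)
  also have "\<dots> \<le> ennreal (v * (2 * L\<^sup>2)) + (\<Sum>i\<in>I. ennreal (v * 4 / N))"
    by (intro add_left_mono sum_mono one)
  also have "(\<Sum>i\<in>I. ennreal (v * 4 / N)) = ennreal (N * (v * 4 / N))"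
    unfolding N_def using v by (subst sum_ennreal) auto
  also have "ennreal (v * (2 * L\<^sup>2)) + ennreal (N * (v * 4 / N)) = ennreal (v * (4 * ln (2 * N) + 4))"
    using N v lnN by (subst ennreal_plus[symmetric]) (auto simp: L2 algebra_simps)
  finally show ?thesis by (simp add: N_def)
qed

text \<open>All that chaining needs from independence is a Gaussian bound on the moment generating function
  of every finite sum, with variance proportional to the number of summands. In this form the
  hypothesis passes to sums over disjoint cells (\<open>subgaussian_field_coarsen\<close>), so that
  one induction covers all scales.\<close>

definition subgaussian_field :: "'a measure \<Rightarrow> real \<Rightarrow> ('a \<Rightarrow> 'i \<Rightarrow> real) \<Rightarrow> bool" where
  "subgaussian_field M v X \<longleftrightarrow> (\<forall>p. (\<lambda>x. X x p) \<in> borel_measurable M) \<and>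
    (\<forall>D l. finite D \<longrightarrow>
      (\<integral>\<^sup>+x. ennreal (exp (l * sum (X x) D)) \<partial>M) \<le> ennreal (exp (l\<^sup>2 * (v * real (card D)) / 2)))"

lemma subgaussian_field_measurable:
  "subgaussian_field M v X \<Longrightarrow> (\<lambda>x. X x p) \<in> borel_measurable M"
  by (auto simp: subgaussian_field_def)

lemma subgaussian_field_mgf:
  "subgaussian_field M v X \<Longrightarrow> finite D \<Longrightarrow>
    (\<integral>\<^sup>+x. ennreal (exp (l * sum (X x) D)) \<partial>M) \<le> ennreal (exp (l\<^sup>2 * (v * real (card D)) / 2))"
  by (auto simp: subgaussian_field_def)

lemma (in prob_space) second_moment_Max_sums_le:
  assumes X: "subgaussian_field M v X"
    and F: "finite F" "F \<noteq> {}" "\<And>D. D \<in> F \<Longrightarrow> finite D \<and> card D \<le> k" and v: "0 < v" "0 < k"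
  shows "(\<integral>\<^sup>+x. ennreal ((Max ((\<lambda>D. \<bar>sum (X x) D\<bar>) ` F))\<^sup>2) \<partial>M)
           \<le> ennreal (v * real k * (4 * ln (2 * real (card F)) + 4))"
proof (rule second_moment_Max_le[OF F(1,2)])
  show "0 < v * real k" using v by simp
next
  fix D assume "D \<in> F"
  show "(\<lambda>x. sum (X x) D) \<in> borel_measurable M"
    by (intro borel_measurable_sum subgaussian_field_measurable[OF X])
next
  fix D l assume D: "D \<in> F"
  have "(\<integral>\<^sup>+x. ennreal (exp (l * sum (X x) D)) \<partial>M) \<le> ennreal (exp (l\<^sup>2 * (v * real (card D)) / 2))"
    using F(3)[OF D] by (intro subgaussian_field_mgf[OF X]) auto
  also have "\<dots> \<le> ennreal (exp (l\<^sup>2 * (v * real k) / 2))"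
    using F(3)[OF D] v by (intro ennreal_leI) (auto intro!: divide_right_mono mult_left_mono)
  finally show "(\<integral>\<^sup>+x. ennreal (exp (l * sum (X x) D)) \<partial>M) \<le> ennreal (exp (l\<^sup>2 * (v * real k) / 2))" .
qed

section \<open>Exponential moments of the noise\<close>

lemma nn_integral_exp_std_normal:
  "(\<integral>\<^sup>+x. ennreal (exp (l * x)) \<partial>density lborel (\<lambda>x. ennreal (std_normal_density x)))
     = ennreal (exp (l\<^sup>2 / 2))"
proof -
  \<comment> \<open>Completing the square: tilting the standard normal density shifts its mean to \<open>l\<close>.\<close>
  have shift: "std_normal_density x * exp (l * x) = exp (l\<^sup>2 / 2) * normal_density l 1 x" for x
  proof -
    have "- (x\<^sup>2 / 2) + l * x = l\<^sup>2 / 2 - (x - l)\<^sup>2 / 2"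
      by (simp add: power2_eq_square field_simps)
    then show ?thesis
      by (simp add: normal_density_def exp_diff flip: exp_add)
  qed
  have "(\<integral>\<^sup>+x. ennreal (exp (l * x)) \<partial>density lborel (\<lambda>x. ennreal (std_normal_density x)))
    = (\<integral>\<^sup>+x. ennreal (exp (l\<^sup>2 / 2)) * ennreal (normal_density l 1 x) \<partial>lborel)"
    by (subst nn_integral_density) (auto simp: shift simp flip: ennreal_mult intro!: nn_integral_cong)
  also have "\<dots> = ennreal (exp (l\<^sup>2 / 2)) * (\<integral>\<^sup>+x. ennreal (normal_density l 1 x) \<partial>lborel)"
    by (rule nn_integral_cmult) auto
  also have "(\<integral>\<^sup>+x. ennreal (normal_density l 1 x) \<partial>lborel) = 1"
    by (subst nn_integral_eq_integral) (auto simp: normal_density_nonneg)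
  finally show ?thesis by simp
qed

lemma prob_space_noise: "prob_space (noise d m)"
  unfolding noise_def by (intro prob_space_PiM prob_space_normal_density) simp

lemma finite_lattice_cube [simp]: "finite (lattice_cube d m)"
  unfolding lattice_cube_def by (intro finite_PiE) auto

lemma measurable_noise [measurable]: "w \<in> lattice_cube d m \<Longrightarrow> (\<lambda>\<epsilon>. \<epsilon> w) \<in> borel_measurable (noise d m)"
  unfolding noise_def
  using measurable_component_singleton[of w "lattice_cube d m" "\<lambda>_. density lborel (\<lambda>x. ennreal (std_normal_density x))"]
  by (simp cong: measurable_cong_sets)

lemma nn_integral_exp_sum_noise:
  assumes "E \<subseteq> lattice_cube d m"
  shows "(\<integral>\<^sup>+\<epsilon>. ennreal (exp (l * sum \<epsilon> E)) \<partial>noise d m) = ennreal (exp (l\<^sup>2 * real (card E) / 2))"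
proof -
  let ?N = "density lborel (\<lambda>x. ennreal (std_normal_density x))"
  let ?L = "lattice_cube d m"
  interpret N: prob_space ?N by (rule prob_space_normal_density) simp
  interpret product_sigma_finite "\<lambda>_::nat \<Rightarrow> nat. ?N"
    by (intro product_sigma_finite.intro N.sigma_finite_measure)
  have prod_if: "(\<Prod>w\<in>?L. if w \<in> E then h w else (1::ennreal)) = (\<Prod>w\<in>E. h w)" for h
    using assms by (simp add: prod.If_cases Int_absorb1 Int_absorb2)
  have fE: "finite E" using assms by (rule finite_subset) simp
  have "(\<integral>\<^sup>+\<epsilon>. ennreal (exp (l * sum \<epsilon> E)) \<partial>noise d m)
     = (\<integral>\<^sup>+\<epsilon>. (\<Prod>w\<in>?L. (if w \<in> E then ennreal (exp (l * \<epsilon> w)) else 1)) \<partial>PiM ?L (\<lambda>_. ?N))"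
    unfolding noise_def prod_if using fE by (simp add: prod_ennreal sum_distrib_left exp_sum)
  also have "\<dots> = (\<Prod>w\<in>?L. \<integral>\<^sup>+t. (if w \<in> E then ennreal (exp (l * t)) else 1) \<partial>?N)"
    by (rule product_nn_integral_prod[of ?L "\<lambda>w t. if w \<in> E then ennreal (exp (l * t)) else 1"]) auto
  also have "\<dots> = (\<Prod>w\<in>?L. if w \<in> E then ennreal (exp (l\<^sup>2 / 2)) else 1)"
    using N.emeasure_space_1 by (intro prod.cong) (auto simp: nn_integral_exp_std_normal)
  also have "\<dots> = ennreal (exp (l\<^sup>2 * real (card E) / 2))"
    unfolding prod_if by (simp add: ennreal_power flip: exp_of_nat_mult)
  finally show ?thesis .
qed

section \<open>Upper sets of a square and their fringes\<close>

definition grid :: "nat \<Rightarrow> (nat \<times> nat) set" where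
  "grid q = {..<q} \<times> {..<q}"

definition upper_sets :: "nat \<Rightarrow> (nat \<times> nat) set set" where
  "upper_sets q = {U. U \<subseteq> grid q \<and>
     (\<forall>i j i' j'. (i, j) \<in> U \<longrightarrow> i \<le> i' \<longrightarrow> j \<le> j' \<longrightarrow> i' < q \<longrightarrow> j' < q \<longrightarrow> (i', j') \<in> U)}"

definition cell :: "nat \<times> nat \<Rightarrow> (nat \<times> nat) set" where
  "cell p = {2 * fst p, 2 * fst p + 1} \<times> {2 * snd p, 2 * snd p + 1}"

definition coarsen :: "(nat \<times> nat \<Rightarrow> real) \<Rightarrow> nat \<times> nat \<Rightarrow> real" where
  "coarsen a p = sum a (cell p)"

text \<open>A cell is represented by its least corner, so that a cell with corner in an upper set lies
  in it entirely (as long as the cell stays inside the square).\<close>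

definition coarse_set :: "(nat \<times> nat) set \<Rightarrow> (nat \<times> nat) set" where
  "coarse_set U = {(i, j). (2 * i, 2 * j) \<in> U}"

text \<open>The points of \<open>U\<close> whose cell is not contained in \<open>U\<close>.\<close>

definition fringe :: "(nat \<times> nat) set \<Rightarrow> (nat \<times> nat) set" where
  "fringe U = {(i, j). (i, j) \<in> U \<and> (2 * (i div 2), 2 * (j div 2)) \<notin> U}"

lemma mem_cell_iff: "(i, j) \<in> cell p \<longleftrightarrow> (i div 2, j div 2) = p"
  by (cases p) (auto simp: cell_def)

lemma finite_cell [simp]: "finite (cell p)" and card_cell [simp]: "card (cell p) = 4"
  by (auto simp: cell_def card_cartesian_product)

lemma disjoint_cells: "p \<noteq> p' \<Longrightarrow> cell p \<inter> cell p' = {}"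
  by (auto simp: mem_cell_iff)

lemma sum_coarsen: "finite V \<Longrightarrow> sum (coarsen a) V = sum a (\<Union> (cell ` V))"
  unfolding coarsen_def by (rule sum.UNION_disjoint[symmetric]) (auto simp: disjoint_cells)

lemma finite_grid [simp]: "finite (grid q)"
  by (simp add: grid_def)

lemma finite_upper_sets [simp]: "finite (upper_sets q)"
  by (rule finite_subset[of _ "Pow (grid q)"]) (auto simp: upper_sets_def)

lemma empty_in_upper_sets: "{} \<in> upper_sets q"
  by (auto simp: upper_sets_def)

lemma finite_upper_set: "U \<in> upper_sets q \<Longrightarrow> finite U"
  unfolding upper_sets_def by (auto intro: finite_subset[OF _ finite_grid])

lemma upper_setD:
  "U \<in> upper_sets q \<Longrightarrow> (i, j) \<in> U \<Longrightarrow> i \<le> i' \<Longrightarrow> j \<le> j' \<Longrightarrow> i' < q \<Longrightarrow> j' < q \<Longrightarrow> (i', j') \<in> U"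
  unfolding upper_sets_def by blast

lemma upper_set_subset: "U \<in> upper_sets q \<Longrightarrow> (i, j) \<in> U \<Longrightarrow> i < q \<and> j < q"
  unfolding upper_sets_def grid_def by auto

text \<open>An upper set is determined by the height at which it starts in each column. Counting all
  height functions, and not only the antitone ones, costs a factor of order \<open>ln q\<close> in the
  entropy, which the logarithmic powers of the final bound absorb.\<close>

lemma card_upper_sets_le: "card (upper_sets q) \<le> (q + 1) ^ q"
proof -
  let ?G = "{..<q} \<rightarrow>\<^sub>E {..q}" and ?f = "\<lambda>g. {(i, j). i < q \<and> g i \<le> j \<and> j < q}"
  have "upper_sets q \<subseteq> ?f ` ?G"
  proof
    fix U assume U: "U \<in> upper_sets q"
    \<comment> \<open>The height \<open>q\<close> encodes an empty column.\<close>
    define g where "g = (\<lambda>i\<in>{..<q}. LEAST j. j = q \<or> (i, j) \<in> U)"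
    have mem: "(i, j) \<in> U \<longleftrightarrow> g i \<le> j" if "i < q" "j < q" for i j
    proof
      assume "(i, j) \<in> U"
      then show "g i \<le> j" using that by (auto simp: g_def intro: Least_le)
    next
      assume gj: "g i \<le> j"
      have "g i = q \<or> (i, g i) \<in> U"
        using LeastI[of "\<lambda>j. j = q \<or> (i, j) \<in> U" q] that by (auto simp: g_def)
      then show "(i, j) \<in> U" using gj that by (auto intro: upper_setD[OF U])
    qed
    have "U = ?f g"
    proof (intro set_eqI)
      fix x show "x \<in> U \<longleftrightarrow> x \<in> ?f g"
        using upper_set_subset[OF U] mem by (cases x) blast
    qed
    moreover have "g \<in> ?G" by (auto simp: g_def intro: Least_le)
    ultimately show "U \<in> ?f ` ?G" by (rule image_eqI)
  qed
  then have "card (upper_sets q) \<le> card (?f ` ?G)"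
    by (intro card_mono finite_imageI finite_PiE) auto
  also have "\<dots> \<le> card ?G" by (intro card_image_le finite_PiE) auto
  also have "\<dots> = (q + 1) ^ q" by (simp add: card_PiE)
  finally show ?thesis .
qed

lemma coarse_set_in_upper_sets:
  assumes "U \<in> upper_sets (2 * q)" shows "coarse_set U \<in> upper_sets q"
proof -
  have "coarse_set U \<subseteq> grid q"
    using upper_set_subset[OF assms] by (fastforce simp: coarse_set_def grid_def)
  moreover have "(i', j') \<in> coarse_set U"
    if "(i, j) \<in> coarse_set U" "i \<le> i'" "j \<le> j'" "i' < q" "j' < q" for i j i' j'
    using that upper_setD[OF assms, of "2 * i" "2 * j" "2 * i'" "2 * j'"] by (auto simp: coarse_set_def)
  ultimately show ?thesis unfolding upper_sets_def by blast
qed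

lemma sum_upper_set_split:
  assumes U: "U \<in> upper_sets (2 * q)"
  shows "sum a U = sum (coarsen a) (coarse_set U) + sum a (fringe U)"
proof -
  have "\<Union> (cell ` coarse_set U) = U - fringe U"
  proof (intro set_eqI iffI)
    fix x assume "x \<in> \<Union> (cell ` coarse_set U)"
    then obtain i j where x: "x = (i, j)" "(2 * (i div 2), 2 * (j div 2)) \<in> U"
      by (cases x) (auto simp: mem_cell_iff coarse_set_def)
    have "i < 2 * q" "j < 2 * q" using upper_set_subset[OF U x(2)] by auto
    then have "(i, j) \<in> U" by (intro upper_setD[OF U x(2)]) auto
    then show "x \<in> U - fringe U" using x by (auto simp: fringe_def)
  next
    fix x assume "x \<in> U - fringe U"
    then show "x \<in> \<Union> (cell ` coarse_set U)"
      by (cases x) (auto simp: fringe_def mem_cell_iff coarse_set_def)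
  qed
  moreover have "finite (coarse_set U)"
    using coarse_set_in_upper_sets[OF U] by (rule finite_upper_set)
  moreover have "fringe U \<subseteq> U" by (auto simp: fringe_def)
  ultimately show ?thesis
    using sum.subset_diff[of "fringe U" U a] finite_upper_set[OF U] by (simp add: sum_coarsen)
qed

text \<open>The size of a fringe is that of a boundary curve, not of an area: if a point of an upper set
  is followed on its diagonal by another point two or more steps further up, the cell of the
  latter has its least corner above the former and so lies in the set. Hence a diagonal meets the
  fringe in at most two points, which have different parity; diagonal and parity therefore
  identify a fringe point.\<close>

lemma card_fringe_le:
  assumes U: "U \<in> upper_sets q"
  shows "finite (fringe U) \<and> card (fringe U) \<le> 4 * q"
proof -
  \<comment> \<open>The shift by \<open>q\<close> makes the index \<open>i - j\<close> of the diagonal a natural number.\<close>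
  let ?key = "\<lambda>(i, j). (q + i - j, i mod 2)"
  have ord: "i' \<le> i" if "(i, j) \<in> fringe U" "(i', j') \<in> fringe U" "q + i - j = q + i' - j'"
     "i mod 2 = i' mod 2" for i j i' j'
  proof (rule ccontr)
    assume lt: "\<not> i' \<le> i"
    have in_U: "(i, j) \<in> U" "(i', j') \<in> U" "(2 * (i' div 2), 2 * (j' div 2)) \<notin> U"
      using that by (auto simp: fringe_def)
    have b: "i < q" "j < q" "i' < q" "j' < q"
      using upper_set_subset[OF U in_U(1)] upper_set_subset[OF U in_U(2)] by auto
    have "i + 2 \<le> i'" using lt that(4) by presburger
    moreover have "j + 2 \<le> j'" using \<open>i + 2 \<le> i'\<close> that(3) b by linarith
    ultimately have "i \<le> 2 * (i' div 2)" "j \<le> 2 * (j' div 2)" by presburger+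
    then have "(2 * (i' div 2), 2 * (j' div 2)) \<in> U"
      using b by (intro upper_setD[OF U in_U(1)]) auto
    then show False using in_U by blast
  qed
  have inj: "inj_on ?key (fringe U)"
  proof (rule inj_onI)
    fix x y assume xy: "x \<in> fringe U" "y \<in> fringe U" "?key x = ?key y"
    obtain i j i' j' where [simp]: "x = (i, j)" "y = (i', j')" by (cases x, cases y)
    have "i = i'" using ord[of i j i' j'] ord[of i' j' i j] xy by (auto intro: antisym)
    moreover have "j < q" "j' < q" using xy upper_set_subset[OF U] by (auto simp: fringe_def)
    ultimately show "x = y" using xy by auto
  qed
  have "?key ` fringe U \<subseteq> {..<2 * q} \<times> {..<2}"
    using upper_set_subset[OF U] by (fastforce simp: fringe_def)
  then have "card (fringe U) \<le> card ({..<2 * q} \<times> {..<2::nat})"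
    by (intro card_inj_on_le[OF inj]) auto
  moreover have "finite (fringe U)"
    by (rule finite_subset[OF _ finite_upper_set[OF U]]) (auto simp: fringe_def)
  ultimately show ?thesis by (simp add: card_cartesian_product)
qed

section \<open>Dyadic chaining\<close>

text \<open>The accumulated cost of the chain: at each scale the worst fringe, then the coarsened field on
  the square of half the side.\<close>

fun chain_bound :: "nat \<Rightarrow> (nat \<times> nat \<Rightarrow> real) \<Rightarrow> real" where
  "chain_bound 0 a = \<bar>a (0, 0)\<bar>"
| "chain_bound (Suc K) a = chain_bound K (coarsen a)
     + Max ((\<lambda>D. \<bar>sum a D\<bar>) ` fringe ` upper_sets (2 ^ Suc K))"

lemma chain_bound_nonneg: "0 \<le> chain_bound K a"
proof (induction K arbitrary: a)
  case (Suc K)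
  have "\<bar>sum a (fringe {})\<bar> \<le> Max ((\<lambda>D. \<bar>sum a D\<bar>) ` fringe ` upper_sets (2 ^ Suc K))"
    using empty_in_upper_sets by (intro Max_ge) auto
  then show ?case using Suc[of "coarsen a"] by simp
qed simp

lemma abs_sum_upper_set_le:
  "U \<in> upper_sets (2 ^ K) \<Longrightarrow> \<bar>sum a U\<bar> \<le> chain_bound K a"
proof (induction K arbitrary: U a)
  case 0
  then have "U \<subseteq> {(0, 0)}" by (auto simp: upper_sets_def grid_def)
  then consider "U = {}" | "U = {(0, 0)}" by blast
  then show ?case by cases auto
next
  case (Suc K)
  then have U: "U \<in> upper_sets (2 * 2 ^ K)" by simp
  have "\<bar>sum a (fringe U)\<bar> \<le> Max ((\<lambda>D. \<bar>sum a D\<bar>) ` fringe ` upper_sets (2 ^ Suc K))"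
    using Suc.prems by (intro Max_ge) auto
  moreover have "\<bar>sum (coarsen a) (coarse_set U)\<bar> \<le> chain_bound K (coarsen a)"
    using coarse_set_in_upper_sets[OF U] by (rule Suc.IH)
  ultimately show ?case using sum_upper_set_split[OF U, of a] by simp
qed

lemma subgaussian_field_coarsen:
  assumes X: "subgaussian_field M v X"
  shows "subgaussian_field M (4 * v) (\<lambda>x. coarsen (X x))"
  unfolding subgaussian_field_def
proof (intro conjI allI impI)
  show "(\<lambda>x. coarsen (X x) p) \<in> borel_measurable M" for p
    unfolding coarsen_def by (intro borel_measurable_sum subgaussian_field_measurable[OF X])
next
  fix D :: "(nat \<times> nat) set" and l :: real
  assume D: "finite D"
  have "card (\<Union> (cell ` D)) = (\<Sum>p\<in>D. card (cell p))"
    using D by (intro card_UN_disjoint) (auto simp: disjoint_cells)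
  then have "v * real (card (\<Union> (cell ` D))) = 4 * v * real (card D)" by (simp only: card_cell) simp
  moreover have "sum (coarsen (X x)) D = sum (X x) (\<Union> (cell ` D))" for x
    by (rule sum_coarsen[OF D])
  ultimately show "(\<integral>\<^sup>+x. ennreal (exp (l * sum (coarsen (X x)) D)) \<partial>M)
      \<le> ennreal (exp (l\<^sup>2 * (4 * v * real (card D)) / 2))"
    using subgaussian_field_mgf[OF X, of "\<Union> (cell ` D)" l] D by auto
qed

lemma measurable_chain_bound:
  "(\<And>p. (\<lambda>x. X x p) \<in> borel_measurable M) \<Longrightarrow> (\<lambda>x. chain_bound K (X x)) \<in> borel_measurable M"
proof (induction K arbitrary: X)
  case 0
  then show ?case by simp
next
  case (Suc K)
  note [measurable] = Suc.prems
  have [measurable]: "(\<lambda>x. chain_bound K (coarsen (X x))) \<in> borel_measurable M"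
    by (rule Suc.IH) (simp add: coarsen_def)
  have [measurable]: "(\<lambda>x. Max ((\<lambda>D. \<bar>sum (X x) D\<bar>) ` fringe ` upper_sets (2 ^ Suc K))) \<in> borel_measurable M"
    by (intro borel_measurable_Max) auto
  show ?case unfolding chain_bound.simps by measurable
qed

text \<open>Induction over the scales, each step doubling \<open>\<sigma>\<close> and halving the side. A fringe at side
  \<open>Q\<close> is a sum with variance at most \<open>4 * \<sigma>\<^sup>2 * Q\<close>, and the logarithm of the number of
  fringes is at most of order \<open>(K + 2) * Q\<close>; the root of the product is
  of order \<open>\<sigma> * Q * (K + 2)\<close>, where \<open>\<sigma> * Q\<close> is the same at all scales. The factor \<open>A\<close> may
  depend on the field in any way: it enters each scale through the Cauchy-Schwarz inequality.\<close>

lemma (in prob_space) nn_integral_mult_chain_bound_le: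
  assumes A[measurable]: "A \<in> borel_measurable M" and A0: "\<And>x. 0 \<le> A x" "0 \<le> \<alpha>"
    and A2: "(\<integral>\<^sup>+x. ennreal ((A x)\<^sup>2) \<partial>M) \<le> ennreal (\<alpha>\<^sup>2)"
    and X: "subgaussian_field M (\<sigma>\<^sup>2) X" and \<sigma>: "0 < \<sigma>"
  shows "(\<integral>\<^sup>+x. ennreal (A x * chain_bound K (X x)) \<partial>M)
           \<le> ennreal (4 * \<alpha> * \<sigma> * 2 ^ K * (real K + 1)\<^sup>2)"
  using X \<sigma>
proof (induction K arbitrary: X \<sigma>)
  case 0
  note [measurable] = subgaussian_field_measurable[OF 0(1)]
  have "(\<integral>\<^sup>+x. ennreal (\<bar>X x (0, 0)\<bar>\<^sup>2) \<partial>M) \<le> ennreal (\<sigma>\<^sup>2 * (4 * ln 2 + 4))"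
    using second_moment_Max_sums_le[OF 0(1), of "{{(0, 0)}}" 1] 0(2) by simp
  also have "\<dots> \<le> ennreal ((4 * \<sigma>)\<^sup>2)"
  proof (rule ennreal_leI)
    have "\<sigma>\<^sup>2 * (4 * ln 2 + 4) \<le> \<sigma>\<^sup>2 * 16"
      using ln_2_less_1 by (intro mult_left_mono) auto
    then show "\<sigma>\<^sup>2 * (4 * ln 2 + 4) \<le> (4 * \<sigma>)\<^sup>2" by (simp add: power_mult_distrib)
  qed
  finally have "(\<integral>\<^sup>+x. ennreal (A x * \<bar>X x (0, 0)\<bar>) \<partial>M) \<le> ennreal (\<alpha> * (4 * \<sigma>))"
    using 0(2) A0 A2 by (intro nn_integral_mult_le_of_second_moments) auto
  then show ?case by (simp add: mult_ac)
next
  case (Suc K)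
  define Q :: nat where "Q = 2 ^ Suc K"
  define F where "F = fringe ` upper_sets Q"
  let ?D = "\<lambda>x. Max ((\<lambda>D. \<bar>sum (X x) D\<bar>) ` F)"
  note [measurable] = subgaussian_field_measurable[OF Suc(2)]
  have Q: "2 \<le> Q" by (simp add: Q_def)
  have F: "finite F" "F \<noteq> {}" "\<And>D. D \<in> F \<Longrightarrow> finite D \<and> card D \<le> 4 * Q"
    using empty_in_upper_sets card_fringe_le by (auto simp: F_def)
  have [measurable]: "?D \<in> borel_measurable M"
    using F by (intro borel_measurable_Max) auto
  have D0: "0 \<le> ?D x" for x
    using F by (subst Max_ge_iff) auto
  have fam: "real (card F) \<le> 2 ^ ((K + 2) * Q)"
  proof -
    have "card F \<le> card (upper_sets Q)" unfolding F_def by (rule card_image_le) simp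
    also have "\<dots> \<le> (Q + 1) ^ Q" by (rule card_upper_sets_le)
    \<comment> \<open>Here \<open>Q + 1 \<le> 2 * Q\<close>, and \<open>2 * Q\<close> is \<open>2 ^ (K + 2)\<close>.\<close>
    also have "\<dots> \<le> (2 ^ (K + 2)) ^ Q"
      using Q by (intro power_mono) (auto simp: Q_def)
    also have "\<dots> = 2 ^ ((K + 2) * Q)" by (rule power_mult[symmetric])
    finally have "real (card F) \<le> real (2 ^ ((K + 2) * Q))" by (rule of_nat_mono)
    then show ?thesis by simp
  qed
  have cF: "0 < card F" using F(1,2) by (simp add: card_gt_0_iff)
  have "ln (2 * real (card F)) \<le> ln (2 ^ ((K + 2) * Q + 1))"
    using fam cF by (subst ln_le_cancel_iff) auto
  also have "\<dots> = real ((K + 2) * Q + 1) * ln 2" by (rule ln_realpow)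
  also have "\<dots> \<le> real ((K + 2) * Q + 1) * 1"
    using ln_2_less_1 by (intro mult_left_mono) auto
  finally have lnF: "ln (2 * real (card F)) \<le> (real K + 2) * real Q + 1"
    by (simp add: algebra_simps)
  have "4 * ln (2 * real (card F)) + 4 \<le> 4 * ((real K + 2) * real Q) + 4 * 2"
    using lnF by linarith
  also have "\<dots> \<le> 4 * ((real K + 2) * real Q) + 4 * real Q"
    using Q by simp
  also have "\<dots> = 4 * ((real K + 3) * real Q)" by (simp add: algebra_simps)
  also have "\<dots> \<le> 4 * ((real K + 2)\<^sup>2 * real Q)"
  proof -
    have "real K + 3 \<le> (real K + 2)\<^sup>2" by (simp add: power2_eq_square algebra_simps)
    then show ?thesis by (intro mult_left_mono mult_right_mono) auto
  qed
  finally have "\<sigma>\<^sup>2 * real (4 * Q) * (4 * ln (2 * real (card F)) + 4)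
      \<le> \<sigma>\<^sup>2 * real (4 * Q) * (4 * ((real K + 2)\<^sup>2 * real Q))"
    by (intro mult_left_mono) auto
  also have "\<dots> = (4 * \<sigma> * real Q * (real K + 2))\<^sup>2"
    by (simp add: power_mult_distrib power2_eq_square)
  finally have "(\<integral>\<^sup>+x. ennreal ((?D x)\<^sup>2) \<partial>M) \<le> ennreal ((4 * \<sigma> * real Q * (real K + 2))\<^sup>2)"
    using Suc(3) Q by (intro order.trans[OF second_moment_Max_sums_le[OF Suc(2) F]] ennreal_leI) auto
  then have fine: "(\<integral>\<^sup>+x. ennreal (A x * ?D x) \<partial>M) \<le> ennreal (\<alpha> * (4 * \<sigma> * real Q * (real K + 2)))"
    using Suc(3) A0 A2 D0 by (intro nn_integral_mult_le_of_second_moments) auto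
  have X': "subgaussian_field M ((2 * \<sigma>)\<^sup>2) (\<lambda>x. coarsen (X x))"
    using subgaussian_field_coarsen[OF Suc(2)] by (simp add: power_mult_distrib)
  have [measurable]: "(\<lambda>x. chain_bound K (coarsen (X x))) \<in> borel_measurable M"
    by (rule measurable_chain_bound[OF subgaussian_field_measurable[OF X']])
  have coarse: "(\<integral>\<^sup>+x. ennreal (A x * chain_bound K (coarsen (X x))) \<partial>M)
      \<le> ennreal (4 * \<alpha> * (2 * \<sigma>) * 2 ^ K * (real K + 1)\<^sup>2)"
    by (rule Suc.IH[OF X']) (use Suc(3) in simp)
  have "(\<integral>\<^sup>+x. ennreal (A x * chain_bound (Suc K) (X x)) \<partial>M)
      = (\<integral>\<^sup>+x. ennreal (A x * chain_bound K (coarsen (X x))) + ennreal (A x * ?D x) \<partial>M)"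
    using A0 D0 chain_bound_nonneg
    by (intro nn_integral_cong, subst ennreal_plus[symmetric]) (auto simp: F_def Q_def distrib_left)
  also have "\<dots> = (\<integral>\<^sup>+x. ennreal (A x * chain_bound K (coarsen (X x))) \<partial>M)
      + (\<integral>\<^sup>+x. ennreal (A x * ?D x) \<partial>M)"
    by (rule nn_integral_add) auto
  also have "\<dots> \<le> ennreal (4 * \<alpha> * (2 * \<sigma>) * 2 ^ K * (real K + 1)\<^sup>2)
      + ennreal (\<alpha> * (4 * \<sigma> * real Q * (real K + 2)))"
    by (intro add_mono coarse fine)
  also have "\<dots> = ennreal (4 * \<alpha> * \<sigma> * 2 ^ Suc K * ((real K + 1)\<^sup>2 + real K + 2))"
    using A0 Suc(3) by (subst ennreal_plus[symmetric]) (auto simp: Q_def algebra_simps)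
  also have "\<dots> \<le> ennreal (4 * \<alpha> * \<sigma> * 2 ^ Suc K * (real (Suc K) + 1)\<^sup>2)"
    using A0 Suc(3) by (intro ennreal_leI mult_left_mono) (auto simp: power2_eq_square algebra_simps)
  finally show ?case .
qed

section \<open>From upper sets to monotone functions\<close>

text \<open>Layer cake: \<open>f p + B\<close> is the integral over \<open>t\<close> from \<open>- B\<close> to \<open>B\<close> of the indicator of
  \<open>t < f p\<close>. The integral contributes \<open>2 * B * w\<close>, and removing the shift by \<open>B\<close> contributes
  \<open>B * w\<close>.\<close>

lemma abs_weighted_sum_le_of_superlevel_sums:
  fixes f a :: "'i \<Rightarrow> real"
  assumes P: "finite P" and B: "0 \<le> B" "\<And>p. p \<in> P \<Longrightarrow> \<bar>f p\<bar> \<le> B"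
    and w: "\<And>t. \<bar>sum a {p\<in>P. t < f p}\<bar> \<le> w"
  shows "\<bar>\<Sum>p\<in>P. a p * f p\<bar> \<le> 3 * B * w"
proof -
  define F where "F t = (\<Sum>p\<in>P. a p * indicator {- B..<f p} t)" for t :: real
  have int: "(\<integral>t. F t \<partial>lborel) = (\<Sum>p\<in>P. a p * (f p + B))" and Fi: "integrable lborel F"
  proof -
    have i1: "integrable lborel (\<lambda>t. a p * indicator {- B..<f p} t)" for p
      by (cases "- B \<le> f p") (auto intro!: integrable_mult_right)
    have i2: "(\<integral>t. a p * indicator {- B..<f p} t \<partial>lborel) = a p * (f p + B)" if "p \<in> P" for p
      using B(2)[OF that] by (simp add: algebra_simps)
    show "integrable lborel F" unfolding F_def by (intro Bochner_Integration.integrable_sum i1)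
    show "(\<integral>t. F t \<partial>lborel) = (\<Sum>p\<in>P. a p * (f p + B))"
      unfolding F_def by (subst Bochner_Integration.integral_sum[OF i1]) (rule sum.cong[OF refl i2])
  qed
  have pt: "norm (F t) \<le> w * indicator {- B..B} t" for t
  proof (cases "t \<in> {- B..B}")
    case True
    have "F t = (\<Sum>p\<in>P. if t < f p then a p else 0)"
      unfolding F_def using True by (intro sum.cong) (auto simp: indicator_def)
    also have "\<dots> = sum a {p\<in>P. t < f p}" using P by (simp add: sum.inter_filter)
    finally show ?thesis using w[of t] True by simp
  next
    case False
    then have "F t = 0" unfolding F_def using B(2) by (intro sum.neutral) (force simp: indicator_def)
    then show ?thesis using False by simp
  qed
  have "\<bar>\<integral>t. F t \<partial>lborel\<bar> \<le> (\<integral>t. w * indicator {- B..B} t \<partial>lborel)"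
    by (intro integral_abs_bound_integral Fi integrable_mult_right) (use pt B(1) in auto)
  also have "\<dots> = 2 * B * w" using B(1) by simp
  finally have F2: "\<bar>\<Sum>p\<in>P. a p * (f p + B)\<bar> \<le> 2 * B * w" by (simp add: int)
  \<comment> \<open>The whole of \<open>P\<close> is a superlevel set too, at any level below \<open>- B\<close>.\<close>
  have "{p\<in>P. - B - 1 < f p} = P" using B(2) by force
  then have "\<bar>sum a P\<bar> \<le> w" using w[of "- B - 1"] by simp
  then have "\<bar>B * sum a P\<bar> \<le> B * w" using B(1) by (simp add: abs_mult mult_left_mono)
  moreover have "(\<Sum>p\<in>P. a p * f p) = (\<Sum>p\<in>P. a p * (f p + B)) - B * sum a P"
    by (simp add: distrib_left sum.distrib sum_distrib_left mult.commute)
  ultimately show ?thesis using F2 by linarith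
qed

section \<open>The least squares estimator\<close>

lemma isotonic_coneD:
  "\<theta> \<in> isotonic_cone d m \<Longrightarrow> u \<in> lattice_cube d m \<Longrightarrow> v \<in> lattice_cube d m \<Longrightarrow>
    (\<And>j. j \<in> {1..d} \<Longrightarrow> u j \<le> v j) \<Longrightarrow> \<theta> u \<le> \<theta> v"
  unfolding isotonic_cone_def coord_le_def by blast

definition clip :: "nat \<Rightarrow> nat \<Rightarrow> real \<Rightarrow> ((nat \<Rightarrow> nat) \<Rightarrow> real) \<Rightarrow> (nat \<Rightarrow> nat) \<Rightarrow> real" where
  "clip d m B \<theta> = (\<lambda>w\<in>lattice_cube d m. max (- B) (min B (\<theta> w)))"

lemma clip_in_cone: "\<theta> \<in> isotonic_cone d m \<Longrightarrow> clip d m B \<theta> \<in> isotonic_cone d m"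
  unfolding isotonic_cone_def clip_def by (auto simp: max.coboundedI2 min.coboundedI2 intro!: max.mono min.mono)

lemma abs_clip_le: "0 \<le> B \<Longrightarrow> w \<in> lattice_cube d m \<Longrightarrow> \<bar>clip d m B \<theta> w\<bar> \<le> B"
  by (auto simp: clip_def)

lemma square_clip_le:
  fixes y t B :: real
  assumes "\<bar>y\<bar> \<le> B"
  shows "(y - max (- B) (min B t))\<^sup>2 \<le> (y - t)\<^sup>2"
    and "B < \<bar>t\<bar> \<Longrightarrow> (y - max (- B) (min B t))\<^sup>2 < (y - t)\<^sup>2"
proof -
  have "\<bar>y - max (- B) (min B t)\<bar> \<le> \<bar>y - t\<bar>" using assms by (auto simp: max_def min_def)
  then show "(y - max (- B) (min B t))\<^sup>2 \<le> (y - t)\<^sup>2" by (simp add: abs_le_square_iff)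
next
  assume "B < \<bar>t\<bar>"
  then have "\<bar>y - max (- B) (min B t)\<bar> < \<bar>y - t\<bar>" using assms by (auto simp: max_def min_def)
  then show "(y - max (- B) (min B t))\<^sup>2 < (y - t)\<^sup>2"
    using abs_le_square_iff[of "y - t" "y - max (- B) (min B t)"] by linarith
qed

lemma sq_dist_clip_le:
  assumes "\<And>w. w \<in> lattice_cube d m \<Longrightarrow> \<bar>Y w\<bar> \<le> B"
  shows "sq_dist d m Y (clip d m B \<theta>) \<le> sq_dist d m Y \<theta>"
  unfolding sq_dist_def clip_def using assms by (intro sum_mono) (auto intro: square_clip_le)

lemma sq_dist_clip_less:
  assumes Y: "\<And>w. w \<in> lattice_cube d m \<Longrightarrow> \<bar>Y w\<bar> \<le> B"
    and w: "w \<in> lattice_cube d m" "B < \<bar>\<theta> w\<bar>"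
  shows "sq_dist d m Y (clip d m B \<theta>) < sq_dist d m Y \<theta>"
  unfolding sq_dist_def
proof (rule sum_strict_mono_ex1)
  show "\<forall>w\<in>lattice_cube d m. (Y w - clip d m B \<theta> w)\<^sup>2 \<le> (Y w - \<theta> w)\<^sup>2"
    using Y by (auto simp: clip_def intro: square_clip_le)
  show "\<exists>w\<in>lattice_cube d m. (Y w - clip d m B \<theta> w)\<^sup>2 < (Y w - \<theta> w)\<^sup>2"
    using Y w by (intro bexI[of _ w]) (auto simp: clip_def intro: square_clip_le)
qed simp

text \<open>Vectors are functions on an infinite type, but extensionality confines the entries off the
  lattice to the single value \<open>undefined\<close>, so the bounded part of the cone is a closed subset of
  a product of compact sets and Tychonoff's theorem applies.\<close>

lemma compact_bounded_isotonic:
  "compact {\<theta> \<in> isotonic_cone d m. \<forall>w\<in>lattice_cube d m. \<bar>\<theta> w\<bar> \<le> B}" (is "compact ?T")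
proof -
  define S where "S = PiE UNIV (\<lambda>w. if w \<in> lattice_cube d m then {- B..B} else {undefined :: real})"
  define Mo where "Mo = {\<theta> :: (nat \<Rightarrow> nat) \<Rightarrow> real. \<forall>u v. u \<in> lattice_cube d m \<and> v \<in> lattice_cube d m \<and> coord_le d u v
      \<longrightarrow> \<theta> u \<le> \<theta> v}"
  have "compactin (product_topology (\<lambda>_. euclidean) UNIV) S"
    unfolding S_def by (subst compactin_PiE) (auto simp: compactin_euclidean_iff)
  then have "compact S" by (simp add: euclidean_product_topology compactin_euclidean_iff)
  moreover have "closed Mo"
    unfolding Mo_def
    by (intro closed_Collect_all closed_Collect_imp open_Collect_const closed_Collect_le
        continuous_on_product_coordinates)
  ultimately have "compact (S \<inter> Mo)" by (rule compact_Int_closed)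
  also have "S \<inter> Mo = ?T"
    unfolding S_def Mo_def isotonic_cone_def extensional_def
    by (auto simp: PiE_def Pi_def abs_le_iff split: if_splits; force)
  finally show ?thesis .
qed

lemma continuous_sq_dist: "continuous_on S (sq_dist d m Y)"
  unfolding sq_dist_def
  by (intro continuous_intros continuous_on_subset[OF continuous_on_product_coordinates]) auto

text \<open>Truncation at a bound for the data shows all claims: it reduces the existence of a
  minimiser to the compact bounded part of the cone, and, since it strictly decreases the distance
  of a vector that exceeds the bound, it forces every minimiser to obey it.\<close>

lemma lse_minimises_and_bounded:
  assumes Y: "\<And>w. w \<in> lattice_cube d m \<Longrightarrow> \<bar>Y w\<bar> \<le> B" and B: "0 \<le> B"
  shows "lse d m Y \<in> isotonic_cone d m"
    and "\<theta> \<in> isotonic_cone d m \<Longrightarrow> sq_dist d m Y (lse d m Y) \<le> sq_dist d m Y \<theta>"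
    and "w \<in> lattice_cube d m \<Longrightarrow> \<bar>lse d m Y w\<bar> \<le> B"
proof -
  let ?T = "{\<theta> \<in> isotonic_cone d m. \<forall>w\<in>lattice_cube d m. \<bar>\<theta> w\<bar> \<le> B}"
  have "(\<lambda>w\<in>lattice_cube d m. 0) \<in> ?T" using B by (auto simp: isotonic_cone_def)
  then have "?T \<noteq> {}" by blast
  then have "\<exists>\<theta>'\<in>?T. \<forall>\<theta>\<in>?T. sq_dist d m Y \<theta>' \<le> sq_dist d m Y \<theta>"
    by (intro continuous_attains_inf compact_bounded_isotonic continuous_sq_dist)
  then obtain \<theta>' where
    T: "\<theta>' \<in> ?T" "\<And>\<theta>. \<theta> \<in> ?T \<Longrightarrow> sq_dist d m Y \<theta>' \<le> sq_dist d m Y \<theta>"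
    by (elim bexE) (rule that, assumption, erule bspec, assumption)
  have "sq_dist d m Y \<theta>' \<le> sq_dist d m Y \<theta>" if "\<theta> \<in> isotonic_cone d m" for \<theta>
  proof -
    have "clip d m B \<theta> \<in> ?T" using that B by (auto simp: clip_in_cone abs_clip_le)
    from T(2)[OF this] show ?thesis using sq_dist_clip_le[of d m Y B \<theta>] Y by simp
  qed
  then have "is_arg_min (sq_dist d m Y) (\<lambda>\<theta>. \<theta> \<in> isotonic_cone d m) \<theta>'"
    using T(1) by (auto simp: is_arg_min_linorder)
  then have "is_arg_min (sq_dist d m Y) (\<lambda>\<theta>. \<theta> \<in> isotonic_cone d m) (lse d m Y)"
    unfolding lse_def arg_min_on_def arg_min_def
    by (rule someI[of "is_arg_min (sq_dist d m Y) (\<lambda>\<theta>. \<theta> \<in> isotonic_cone d m)"])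
  then have min: "lse d m Y \<in> isotonic_cone d m"
    "\<And>\<theta>. \<theta> \<in> isotonic_cone d m \<Longrightarrow> sq_dist d m Y (lse d m Y) \<le> sq_dist d m Y \<theta>"
    by (auto simp: is_arg_min_linorder)
  show "lse d m Y \<in> isotonic_cone d m" by (rule min)
  show "\<theta> \<in> isotonic_cone d m \<Longrightarrow> sq_dist d m Y (lse d m Y) \<le> sq_dist d m Y \<theta>" by (rule min)
  show "\<bar>lse d m Y w\<bar> \<le> B" if w: "w \<in> lattice_cube d m"
  proof (rule ccontr)
    assume "\<not> \<bar>lse d m Y w\<bar> \<le> B"
    then have "sq_dist d m Y (clip d m B (lse d m Y)) < sq_dist d m Y (lse d m Y)"
      using Y w by (intro sq_dist_clip_less) auto
    then show False using min(2)[OF clip_in_cone[OF min(1)], of B] by simp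
  qed
qed

text \<open>The basic inequality of least squares, by expanding the squares.\<close>

lemma sq_dist_le_of_closer_to_observation:
  assumes "sq_dist d m Y \<theta> \<le> sq_dist d m Y \<theta>\<^sub>0"
    and Y: "\<And>w. w \<in> lattice_cube d m \<Longrightarrow> Y w = \<theta>\<^sub>0 w + \<epsilon> w"
  shows "sq_dist d m \<theta> \<theta>\<^sub>0
    \<le> 2 * ((\<Sum>w\<in>lattice_cube d m. \<epsilon> w * \<theta> w) - (\<Sum>w\<in>lattice_cube d m. \<epsilon> w * \<theta>\<^sub>0 w))"
proof -
  have "sq_dist d m Y \<theta> = (\<Sum>w\<in>lattice_cube d m. (\<theta>\<^sub>0 w + \<epsilon> w - \<theta> w)\<^sup>2)"
    "sq_dist d m Y \<theta>\<^sub>0 = (\<Sum>w\<in>lattice_cube d m. (\<theta>\<^sub>0 w + \<epsilon> w - \<theta>\<^sub>0 w)\<^sup>2)"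
    unfolding sq_dist_def by (auto intro!: sum.cong simp: Y)
  then have "(\<Sum>w\<in>lattice_cube d m. (\<theta>\<^sub>0 w + \<epsilon> w - \<theta> w)\<^sup>2 - (\<theta>\<^sub>0 w + \<epsilon> w - \<theta>\<^sub>0 w)\<^sup>2) \<le> 0"
    using assms(1) by (simp add: sum_subtractf)
  moreover have "sq_dist d m \<theta> \<theta>\<^sub>0
      - 2 * ((\<Sum>w\<in>lattice_cube d m. \<epsilon> w * \<theta> w) - (\<Sum>w\<in>lattice_cube d m. \<epsilon> w * \<theta>\<^sub>0 w))
    = (\<Sum>w\<in>lattice_cube d m. (\<theta>\<^sub>0 w + \<epsilon> w - \<theta> w)\<^sup>2 - (\<theta>\<^sub>0 w + \<epsilon> w - \<theta>\<^sub>0 w)\<^sup>2)"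
    unfolding sq_dist_def sum_subtractf[symmetric] sum_distrib_left
    by (intro sum.cong) (auto simp: power2_eq_square algebra_simps)
  ultimately show ?thesis by linarith
qed

section \<open>Two-dimensional slices of the cube\<close>

definition slices :: "nat \<Rightarrow> nat \<Rightarrow> (nat \<Rightarrow> nat) set" where
  "slices d m = {3..d} \<rightarrow>\<^sub>E {1..m}"

definition slice_point :: "(nat \<Rightarrow> nat) \<Rightarrow> nat \<times> nat \<Rightarrow> nat \<Rightarrow> nat" where
  "slice_point r p = r(1 := Suc (fst p), 2 := Suc (snd p))"

text \<open>Points of the plane are counted from \<open>0\<close>, those of the cube from \<open>1\<close>. The noise is extended by
  \<open>0\<close> outside the slice, which allows the side of the square to be rounded up to a power of two.\<close>

definition slice_noise :: "nat \<Rightarrow> (nat \<Rightarrow> nat) \<Rightarrow> ((nat \<Rightarrow> nat) \<Rightarrow> real) \<Rightarrow> nat \<times> nat \<Rightarrow> real" where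
  "slice_noise m r \<epsilon> p = (if p \<in> grid m then \<epsilon> (slice_point r p) else 0)"

lemma finite_slices [simp]: "finite (slices d m)"
  unfolding slices_def by (intro finite_PiE) auto

lemma card_slices: "card (slices d m) = m ^ (d - 2)"
  unfolding slices_def by (simp add: card_PiE)

lemma slice_point_in_cube:
  assumes "2 \<le> d" "r \<in> slices d m" "p \<in> grid m"
  shows "slice_point r p \<in> lattice_cube d m"
  using assms unfolding slice_point_def slices_def lattice_cube_def grid_def
  by (auto simp: PiE_def Pi_def extensional_def)

lemma inj_slice_point: "inj (slice_point r)"
proof (rule injI)
  fix p q assume "slice_point r p = slice_point r q"
  from fun_cong[OF this, of 1] fun_cong[OF this, of 2] show "p = q"
    by (simp add: slice_point_def prod_eq_iff)
qed

lemma sum_lattice_cube_slices: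
  assumes d: "2 \<le> d"
  shows "(\<Sum>w\<in>lattice_cube d m. g w) = (\<Sum>r\<in>slices d m. \<Sum>p\<in>grid m. g (slice_point r p))"
proof -
  have "bij_betw (\<lambda>(r, p). slice_point r p) (slices d m \<times> grid m) (lattice_cube d m)"
  proof (rule bij_betw_byWitness[where f' = "\<lambda>w. (restrict w {3..d}, (w 1 - 1, w 2 - 1))"])
    show "\<forall>x\<in>slices d m \<times> grid m. (\<lambda>w. (restrict w {3..d}, (w 1 - 1, w 2 - 1))) ((\<lambda>(r, p). slice_point r p) x) = x"
      by (auto simp: slice_point_def slices_def PiE_def extensional_def restrict_def fun_eq_iff)
    show "\<forall>w\<in>lattice_cube d m. (\<lambda>(r, p). slice_point r p) (restrict w {3..d}, (w 1 - 1, w 2 - 1)) = w"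
    proof
      fix w assume w: "w \<in> lattice_cube d m"
      have w12: "1 \<le> w 1" "1 \<le> w 2" using w d by (auto simp: lattice_cube_def PiE_def Pi_def)
      have "slice_point (restrict w {3..d}) (w 1 - 1, w 2 - 1) i = w i" for i
      proof -
        consider "i = 1" | "i = 2" | "i \<in> {3..d}" | "i \<notin> {1..d}" using d by force
        then show ?thesis
          using w12 w by cases (auto simp: slice_point_def lattice_cube_def PiE_def extensional_def)
      qed
      then show "(\<lambda>(r, p). slice_point r p) (restrict w {3..d}, (w 1 - 1, w 2 - 1)) = w"
        by (simp add: fun_eq_iff)
    qed
    show "(\<lambda>(r, p). slice_point r p) ` (slices d m \<times> grid m) \<subseteq> lattice_cube d m"
      using slice_point_in_cube[OF d] by auto
    show "(\<lambda>w. (restrict w {3..d}, (w 1 - 1, w 2 - 1))) ` lattice_cube d m \<subseteq> slices d m \<times> grid m"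
    proof
      fix x assume "x \<in> (\<lambda>w. (restrict w {3..d}, (w 1 - 1, w 2 - 1))) ` lattice_cube d m"
      then obtain w where x: "x = (restrict w {3..d}, (w 1 - 1, w 2 - 1))" and w: "w \<in> lattice_cube d m" by auto
      have wj: "j \<in> {1..d} \<Longrightarrow> 1 \<le> w j \<and> w j \<le> m" for j
        using w by (auto simp: lattice_cube_def PiE_def Pi_def)
      have "w 1 - 1 < m" "w 2 - 1 < m" using wj[of 1] wj[of 2] d by auto
      moreover have "restrict w {3..d} \<in> slices d m" using wj by (auto simp: slices_def)
      ultimately show "x \<in> slices d m \<times> grid m" by (simp add: x grid_def)
    qed
  qed
  from sum.reindex_bij_betw[OF this, of g] show ?thesis
    unfolding sum.cartesian_product by (simp only: case_prod_unfold)
qed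

lemma subgaussian_slice_noise:
  assumes d: "2 \<le> d" and r: "r \<in> slices d m"
  shows "subgaussian_field (noise d m) 1 (slice_noise m r)"
  unfolding subgaussian_field_def
proof (intro conjI allI impI)
  show "(\<lambda>\<epsilon>. slice_noise m r \<epsilon> p) \<in> borel_measurable (noise d m)" for p
  proof (cases "p \<in> grid m")
    case True
    show ?thesis
      unfolding slice_noise_def if_P[OF True]
      by (rule measurable_noise[OF slice_point_in_cube[OF d r True]])
  next
    case False
    show ?thesis unfolding slice_noise_def if_not_P[OF False] by (rule borel_measurable_const)
  qed
next
  fix D :: "(nat \<times> nat) set" and l :: real
  assume D: "finite D"
  define E where "E = slice_point r ` (D \<inter> grid m)"
  have E: "E \<subseteq> lattice_cube d m" using slice_point_in_cube[OF d r] by (auto simp: E_def)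
  have "sum (slice_noise m r \<epsilon>) D = sum \<epsilon> E" for \<epsilon>
    unfolding E_def slice_noise_def using D inj_slice_point
    by (simp add: sum.reindex inj_on_subset[OF inj_slice_point] sum.inter_restrict)
  moreover have "card E \<le> card D"
    unfolding E_def using D by (meson card_image_le card_mono finite_Int inf_le1 order.trans)
  ultimately show "(\<integral>\<^sup>+\<epsilon>. ennreal (exp (l * sum (slice_noise m r \<epsilon>) D)) \<partial>noise d m)
      \<le> ennreal (exp (l\<^sup>2 * (1 * real (card D)) / 2))"
    using nn_integral_exp_sum_noise[OF E, of l]
    by (auto intro!: ennreal_leI divide_right_mono mult_left_mono)
qed

text \<open>A monotone function on the slice extends to a monotone function with the same bounds on the
  larger square by repeating its last row and column, and the noise vanishes on the added points.
  The superlevel sets of the extension are upper sets, to which chaining applies.\<close>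

lemma abs_slice_inner_le:
  assumes d: "2 \<le> d" and m: "1 \<le> m" "m \<le> 2 ^ K" and r: "r \<in> slices d m"
    and \<theta>: "\<theta> \<in> isotonic_cone d m" "\<And>w. w \<in> lattice_cube d m \<Longrightarrow> \<bar>\<theta> w\<bar> \<le> B" and B: "0 \<le> B"
  shows "\<bar>\<Sum>p\<in>grid m. \<epsilon> (slice_point r p) * \<theta> (slice_point r p)\<bar> \<le> 3 * B * chain_bound K (slice_noise m r \<epsilon>)"
proof -
  \<comment> \<open>The nearest point of the slice.\<close>
  define cl where "cl p = (min (fst p) (m - 1), min (snd p) (m - 1))" for p :: "nat \<times> nat"
  define f where "f p = \<theta> (slice_point r (cl p))" for p
  let ?a = "slice_noise m r \<epsilon>" and ?P = "grid (2 ^ K)"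
  have cl: "cl p \<in> grid m" for p using m by (auto simp: cl_def grid_def)
  have cl_id: "cl p = p" if "p \<in> grid m" for p using that m by (auto simp: cl_def grid_def)
  have mono: "f (i, j) \<le> f (i', j')" if "i \<le> i'" "j \<le> j'" for i j i' j'
    unfolding f_def
  proof (rule isotonic_coneD[OF \<theta>(1)])
    fix k
    show "slice_point r (cl (i, j)) k \<le> slice_point r (cl (i', j')) k"
      using that by (auto simp: slice_point_def cl_def intro: min.mono)
  qed (intro slice_point_in_cube[OF d r cl])+
  have up: "{p \<in> ?P. t < f p} \<in> upper_sets (2 ^ K)" for t
    unfolding upper_sets_def using mono by (auto simp: grid_def intro: less_le_trans)
  have "\<bar>\<Sum>p\<in>?P. ?a p * f p\<bar> \<le> 3 * B * chain_bound K ?a"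
  proof (rule abs_weighted_sum_le_of_superlevel_sums)
    show "\<bar>f p\<bar> \<le> B" for p unfolding f_def by (intro \<theta>(2) slice_point_in_cube[OF d r cl])
    show "\<bar>sum ?a {p \<in> ?P. t < f p}\<bar> \<le> chain_bound K ?a" for t
      by (rule abs_sum_upper_set_le[OF up])
  qed (use B in auto)
  moreover have "(\<Sum>p\<in>grid m. \<epsilon> (slice_point r p) * \<theta> (slice_point r p)) = (\<Sum>p\<in>?P. ?a p * f p)"
    using m by (intro sum.mono_neutral_cong_left) (auto simp: slice_noise_def f_def cl_id, auto simp: grid_def)
  ultimately show ?thesis by simp
qed

lemma abs_noise_inner_isotonic_le:
  assumes "2 \<le> d" "1 \<le> m" "m \<le> 2 ^ K"
    and "\<theta> \<in> isotonic_cone d m" "\<And>w. w \<in> lattice_cube d m \<Longrightarrow> \<bar>\<theta> w\<bar> \<le> B" "0 \<le> B"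
  shows "\<bar>\<Sum>w\<in>lattice_cube d m. \<epsilon> w * \<theta> w\<bar> \<le> 3 * B * (\<Sum>r\<in>slices d m. chain_bound K (slice_noise m r \<epsilon>))"
proof -
  have "\<bar>\<Sum>w\<in>lattice_cube d m. \<epsilon> w * \<theta> w\<bar>
      \<le> (\<Sum>r\<in>slices d m. \<bar>\<Sum>p\<in>grid m. \<epsilon> (slice_point r p) * \<theta> (slice_point r p)\<bar>)"
    unfolding sum_lattice_cube_slices[OF assms(1)] by (rule sum_abs)
  also have "\<dots> \<le> (\<Sum>r\<in>slices d m. 3 * B * chain_bound K (slice_noise m r \<epsilon>))"
    using assms by (intro sum_mono abs_slice_inner_le) auto
  finally show ?thesis by (simp add: sum_distrib_left)
qed

section \<open>The risk bound\<close>

text \<open>Combines the basic inequality with the bound \<open>1 + \<mu>\<close> on the estimator and the bound \<open>1\<close> on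
  the signal, where \<open>\<mu>\<close> is the maximal absolute noise; hence the factor \<open>2 + \<mu>\<close>.\<close>

lemma loss_le:
  assumes d: "2 \<le> d" and m: "1 \<le> m" "m \<le> 2 ^ K"
    and \<theta>\<^sub>0: "\<theta>\<^sub>0 \<in> isotonic_cone d m" "\<theta>\<^sub>0 \<in> sup_norm_unit_ball d m"
  shows "sq_dist d m (lse d m (\<lambda>w\<in>lattice_cube d m. \<theta>\<^sub>0 w + \<epsilon> w)) \<theta>\<^sub>0
    \<le> (\<Sum>r\<in>slices d m. 6 * ((2 + Max ((\<lambda>w. \<bar>\<epsilon> w\<bar>) ` lattice_cube d m)) * chain_bound K (slice_noise m r \<epsilon>)))"
proof -
  let ?L = "lattice_cube d m"
  define mx where "mx = Max ((\<lambda>w. \<bar>\<epsilon> w\<bar>) ` ?L)"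
  define Y where "Y = (\<lambda>w\<in>?L. \<theta>\<^sub>0 w + \<epsilon> w)"
  define G where "G = (\<Sum>r\<in>slices d m. chain_bound K (slice_noise m r \<epsilon>))"
  have \<theta>1: "w \<in> ?L \<Longrightarrow> \<bar>\<theta>\<^sub>0 w\<bar> \<le> 1" for w using \<theta>\<^sub>0(2) by (auto simp: sup_norm_unit_ball_def)
  have mx: "w \<in> ?L \<Longrightarrow> \<bar>\<epsilon> w\<bar> \<le> mx" for w unfolding mx_def by (intro Max_ge) auto
  have "(\<lambda>j\<in>{1..d}. 1) \<in> ?L" using m by (auto simp: lattice_cube_def)
  from mx[OF this] have mx0: "0 \<le> mx" by linarith
  have YB: "\<bar>Y w\<bar> \<le> 1 + mx" if "w \<in> ?L" for w
    using \<theta>1[OF that] mx[OF that] that by (simp add: Y_def)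
  have est: "lse d m Y \<in> isotonic_cone d m" "sq_dist d m Y (lse d m Y) \<le> sq_dist d m Y \<theta>\<^sub>0"
    "\<And>w. w \<in> ?L \<Longrightarrow> \<bar>lse d m Y w\<bar> \<le> 1 + mx"
    using lse_minimises_and_bounded[of d m Y "1 + mx"] YB mx0 \<theta>\<^sub>0(1) by auto
  have "sq_dist d m (lse d m Y) \<theta>\<^sub>0
      \<le> 2 * ((\<Sum>w\<in>?L. \<epsilon> w * lse d m Y w) - (\<Sum>w\<in>?L. \<epsilon> w * \<theta>\<^sub>0 w))"
    by (rule sq_dist_le_of_closer_to_observation[OF est(2)]) (simp add: Y_def)
  also have "\<dots> \<le> 2 * (3 * (1 + mx) * G + 3 * 1 * G)"
  proof -
    have "\<bar>\<Sum>w\<in>?L. \<epsilon> w * lse d m Y w\<bar> \<le> 3 * (1 + mx) * G"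
      unfolding G_def by (rule abs_noise_inner_isotonic_le[OF d m est(1) est(3)]) (use mx0 in auto)
    moreover have "\<bar>\<Sum>w\<in>?L. \<epsilon> w * \<theta>\<^sub>0 w\<bar> \<le> 3 * 1 * G"
      unfolding G_def by (rule abs_noise_inner_isotonic_le[OF d m \<theta>\<^sub>0(1) \<theta>1]) auto
    ultimately show ?thesis
      unfolding diff_conv_add_uminus by (intro mult_left_mono add_mono) (auto dest: abs_le_D1 abs_le_D2)
  qed
  also have "\<dots> = 6 * ((2 + mx) * G)" by (simp add: algebra_simps)
  finally show ?thesis by (simp add: Y_def mx_def G_def sum_distrib_left)
qed

lemma second_moment_max_noise_le:
  assumes "1 \<le> m"
  shows "(\<integral>\<^sup>+\<epsilon>. ennreal ((2 + Max ((\<lambda>w. \<bar>\<epsilon> w\<bar>) ` lattice_cube d m))\<^sup>2) \<partial>noise d m)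
    \<le> ennreal (8 * ln (2 * real (m ^ d)) + 16)"
proof -
  interpret prob_space "noise d m" by (rule prob_space_noise)
  let ?L = "lattice_cube d m"
  let ?M = "\<lambda>\<epsilon> :: (nat \<Rightarrow> nat) \<Rightarrow> real. Max ((\<lambda>w. \<bar>\<epsilon> w\<bar>) ` ?L)"
  have [measurable]: "?M \<in> borel_measurable (noise d m)"
    by (intro borel_measurable_Max) auto
  have card: "card ?L = m ^ d" by (simp add: lattice_cube_def card_PiE)
  then have ne: "?L \<noteq> {}" using assms by (auto simp: card_eq_0_iff)
  have "(\<integral>\<^sup>+\<epsilon>. ennreal ((?M \<epsilon>)\<^sup>2) \<partial>noise d m) \<le> ennreal (1 * (4 * ln (2 * real (card ?L)) + 4))"
  proof (rule second_moment_Max_le[OF finite_lattice_cube ne])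
    fix w l assume "w \<in> ?L"
    then show "(\<integral>\<^sup>+\<epsilon>. ennreal (exp (l * \<epsilon> w)) \<partial>noise d m) \<le> ennreal (exp (l\<^sup>2 * 1 / 2))"
      using nn_integral_exp_sum_noise[of "{w}" d m l] by simp
  qed auto
  then have M2: "(\<integral>\<^sup>+\<epsilon>. ennreal ((?M \<epsilon>)\<^sup>2) \<partial>noise d m) \<le> ennreal (4 * ln (2 * real (m ^ d)) + 4)"
    by (simp only: card mult_1)
  have ln0: "0 \<le> ln (2 * real (m ^ d))"
  proof (rule ln_ge_zero)
    have "1 \<le> real (m ^ d)" using one_le_power[OF assms, of d] by linarith
    then show "1 \<le> 2 * real (m ^ d)" by linarith
  qed
  have "(\<integral>\<^sup>+\<epsilon>. ennreal ((2 + ?M \<epsilon>)\<^sup>2) \<partial>noise d m)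
      \<le> (\<integral>\<^sup>+\<epsilon>. ennreal 8 + ennreal 2 * ennreal ((?M \<epsilon>)\<^sup>2) \<partial>noise d m)"
  proof (rule nn_integral_mono)
    fix \<epsilon> :: "(nat \<Rightarrow> nat) \<Rightarrow> real"
    have "(2 + ?M \<epsilon>)\<^sup>2 \<le> 8 + 2 * (?M \<epsilon>)\<^sup>2"
      using zero_le_power2[of "2 - ?M \<epsilon>"] by (simp add: power2_eq_square algebra_simps)
    then have "ennreal ((2 + ?M \<epsilon>)\<^sup>2) \<le> ennreal (8 + 2 * (?M \<epsilon>)\<^sup>2)" by (rule ennreal_leI)
    also have "\<dots> = ennreal 8 + ennreal 2 * ennreal ((?M \<epsilon>)\<^sup>2)"
      by (subst ennreal_mult[symmetric], simp, simp, subst ennreal_plus[symmetric]) auto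
    finally show "ennreal ((2 + ?M \<epsilon>)\<^sup>2) \<le> ennreal 8 + ennreal 2 * ennreal ((?M \<epsilon>)\<^sup>2)" .
  qed
  also have "\<dots> = ennreal 8 + ennreal 2 * (\<integral>\<^sup>+\<epsilon>. ennreal ((?M \<epsilon>)\<^sup>2) \<partial>noise d m)"
    by (subst nn_integral_add, simp, simp, subst nn_integral_cmult) (auto simp: emeasure_space_1)
  also have "\<dots> \<le> ennreal 8 + ennreal 2 * ennreal (4 * ln (2 * real (m ^ d)) + 4)"
    by (intro add_left_mono mult_left_mono M2) simp
  also have "\<dots> = ennreal (8 * ln (2 * real (m ^ d)) + 16)"
    using ln0 by (subst ennreal_mult[symmetric], simp, linarith, subst ennreal_plus[symmetric]) auto
  finally show ?thesis .
qed

text \<open>The loss is dominated pointwise by a measurable function, and only the latter is evaluated: the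
  estimator itself is given by an arbitrary choice of a minimiser. The factor \<open>m ^ (d - 2)\<close> from the number of slices cancels
  against \<open>m ^ d\<close>.\<close>

lemma risk_lse_le:
  assumes d: "2 \<le> d" and m: "1 \<le> m" "m \<le> 2 ^ K"
    and \<theta>\<^sub>0: "\<theta>\<^sub>0 \<in> isotonic_cone d m" "\<theta>\<^sub>0 \<in> sup_norm_unit_ball d m"
    and \<alpha>: "0 \<le> \<alpha>" "8 * ln (2 * real (m ^ d)) + 16 \<le> \<alpha>\<^sup>2"
  shows "risk d m (lse d m) \<theta>\<^sub>0 \<le> ennreal (24 * \<alpha> * 2 ^ K * (real K + 1)\<^sup>2 / (real m)\<^sup>2)"
proof -
  interpret prob_space "noise d m" by (rule prob_space_noise)
  define A where "A \<epsilon> = 2 + Max ((\<lambda>w. \<bar>\<epsilon> w\<bar>) ` lattice_cube d m)" for \<epsilon> :: "(nat \<Rightarrow> nat) \<Rightarrow> real"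
  define c where "c = 6 / real (m ^ d)"
  have c0: "0 \<le> c" by (simp add: c_def)
  have [measurable]: "A \<in> borel_measurable (noise d m)"
    unfolding A_def by (intro borel_measurable_add borel_measurable_Max) auto
  have "card (lattice_cube d m) = m ^ d" by (simp add: lattice_cube_def card_PiE)
  then have ne: "lattice_cube d m \<noteq> {}" using m by (auto simp: card_eq_0_iff)
  have A0: "0 \<le> A \<epsilon>" for \<epsilon>
  proof -
    have "0 \<le> Max ((\<lambda>w. \<bar>\<epsilon> w\<bar>) ` lattice_cube d m)" using ne by (subst Max_ge_iff) auto
    then show ?thesis by (simp add: A_def)
  qed
  have A2: "(\<integral>\<^sup>+\<epsilon>. ennreal ((A \<epsilon>)\<^sup>2) \<partial>noise d m) \<le> ennreal (\<alpha>\<^sup>2)"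
    unfolding A_def using second_moment_max_noise_le[OF m(1), of d] ennreal_leI[OF \<alpha>(2)] by (rule order.trans)
  have cb: "(\<lambda>\<epsilon>. chain_bound K (slice_noise m r \<epsilon>)) \<in> borel_measurable (noise d m)"
    if "r \<in> slices d m" for r
    by (rule measurable_chain_bound[OF subgaussian_field_measurable[OF subgaussian_slice_noise[OF d that]]])
  have A_cb: "(\<lambda>\<epsilon>. ennreal (A \<epsilon> * chain_bound K (slice_noise m r \<epsilon>))) \<in> borel_measurable (noise d m)"
    if "r \<in> slices d m" for r
    using cb[OF that] by measurable
  have slice: "(\<integral>\<^sup>+\<epsilon>. ennreal (A \<epsilon> * chain_bound K (slice_noise m r \<epsilon>)) \<partial>noise d m)
      \<le> ennreal (4 * \<alpha> * 2 ^ K * (real K + 1)\<^sup>2)" if r: "r \<in> slices d m" for r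
    using nn_integral_mult_chain_bound_le[OF _ A0 \<alpha>(1) A2, of 1 "slice_noise m r" K]
      subgaussian_slice_noise[OF d r] by simp
  have "risk d m (lse d m) \<theta>\<^sub>0
      \<le> (\<integral>\<^sup>+\<epsilon>. (\<Sum>r\<in>slices d m. ennreal c * ennreal (A \<epsilon> * chain_bound K (slice_noise m r \<epsilon>))) \<partial>noise d m)"
    unfolding risk_def
  proof (rule nn_integral_mono)
    fix \<epsilon> :: "(nat \<Rightarrow> nat) \<Rightarrow> real"
    have "1 / real (m ^ d) * sq_dist d m (lse d m (\<lambda>w\<in>lattice_cube d m. \<theta>\<^sub>0 w + \<epsilon> w)) \<theta>\<^sub>0
       \<le> 1 / real (m ^ d) * (\<Sum>r\<in>slices d m. 6 * (A \<epsilon> * chain_bound K (slice_noise m r \<epsilon>)))"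
      unfolding A_def by (intro mult_left_mono loss_le[OF d m \<theta>\<^sub>0]) simp
    also have "\<dots> = (\<Sum>r\<in>slices d m. c * (A \<epsilon> * chain_bound K (slice_noise m r \<epsilon>)))"
      unfolding sum_distrib_left by (intro sum.cong) (auto simp: c_def)
    finally have "ennreal (1 / real (m ^ d) * sq_dist d m (lse d m (\<lambda>w\<in>lattice_cube d m. \<theta>\<^sub>0 w + \<epsilon> w)) \<theta>\<^sub>0)
       \<le> ennreal (\<Sum>r\<in>slices d m. c * (A \<epsilon> * chain_bound K (slice_noise m r \<epsilon>)))"
      by (rule ennreal_leI)
    also have "\<dots> = (\<Sum>r\<in>slices d m. ennreal (c * (A \<epsilon> * chain_bound K (slice_noise m r \<epsilon>))))"
      using c0 A0 chain_bound_nonneg by (intro sum_ennreal[symmetric]) auto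
    also have "\<dots> = (\<Sum>r\<in>slices d m. ennreal c * ennreal (A \<epsilon> * chain_bound K (slice_noise m r \<epsilon>)))"
      using c0 A0 chain_bound_nonneg by (intro sum.cong ennreal_mult) auto
    finally show "ennreal (1 / real (m ^ d) * sq_dist d m (lse d m (\<lambda>w\<in>lattice_cube d m. \<theta>\<^sub>0 w + \<epsilon> w)) \<theta>\<^sub>0)
       \<le> (\<Sum>r\<in>slices d m. ennreal c * ennreal (A \<epsilon> * chain_bound K (slice_noise m r \<epsilon>)))" .
  qed
  also have "\<dots> = (\<Sum>r\<in>slices d m. \<integral>\<^sup>+\<epsilon>. ennreal c * ennreal (A \<epsilon> * chain_bound K (slice_noise m r \<epsilon>)) \<partial>noise d m)"
    by (rule nn_integral_sum) (use A_cb in measurable)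
  also have "\<dots> \<le> (\<Sum>r\<in>slices d m. ennreal (c * (4 * \<alpha> * 2 ^ K * (real K + 1)\<^sup>2)))"
  proof (rule sum_mono)
    fix r assume r: "r \<in> slices d m"
    have "(\<integral>\<^sup>+\<epsilon>. ennreal c * ennreal (A \<epsilon> * chain_bound K (slice_noise m r \<epsilon>)) \<partial>noise d m)
      = ennreal c * (\<integral>\<^sup>+\<epsilon>. ennreal (A \<epsilon> * chain_bound K (slice_noise m r \<epsilon>)) \<partial>noise d m)"
      by (rule nn_integral_cmult[OF A_cb[OF r]])
    also have "\<dots> \<le> ennreal c * ennreal (4 * \<alpha> * 2 ^ K * (real K + 1)\<^sup>2)"
      by (intro mult_left_mono slice[OF r]) simp
    also have "\<dots> = ennreal (c * (4 * \<alpha> * 2 ^ K * (real K + 1)\<^sup>2))"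
      using c0 \<alpha>(1) by (intro ennreal_mult[symmetric]) auto
    finally show "(\<integral>\<^sup>+\<epsilon>. ennreal c * ennreal (A \<epsilon> * chain_bound K (slice_noise m r \<epsilon>)) \<partial>noise d m)
      \<le> ennreal (c * (4 * \<alpha> * 2 ^ K * (real K + 1)\<^sup>2))" .
  qed
  also have "\<dots> = ennreal (real (m ^ (d - 2)) * (c * (4 * \<alpha> * 2 ^ K * (real K + 1)\<^sup>2)))"
    using c0 \<alpha>(1) by (subst sum_ennreal) (auto simp: card_slices)
  also have "real (m ^ (d - 2)) * (c * (4 * \<alpha> * 2 ^ K * (real K + 1)\<^sup>2))
      = 24 * \<alpha> * 2 ^ K * (real K + 1)\<^sup>2 / (real m)\<^sup>2"
  proof -
    have "m ^ d = m ^ (d - 2) * m\<^sup>2"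
      using power_add[of m "d - 2" 2] d by (simp only: le_add_diff_inverse2)
    then have "real (m ^ d) = real (m ^ (d - 2)) * (real m)\<^sup>2" by simp
    then show ?thesis using m by (simp add: c_def divide_simps)
  qed
  finally show ?thesis .
qed

theorem theorem1:
  shows "\<exists>C::real. C > 0 \<and>
    (\<forall>(d::nat) (n::nat) (m::nat). d \<ge> 2 \<longrightarrow> n \<ge> 2 \<longrightarrow> n = m ^ d \<longrightarrow>
      (SUP \<theta>\<^sub>0 \<in> isotonic_cone d m \<inter> sup_norm_unit_ball d m. risk d m (lse d m) \<theta>\<^sub>0)
        \<le> ennreal (C * real n powr (- 1 / real d) * (ln (real n)) ^ 4))"
proof (intro exI[of _ "7200::real"] conjI allI impI SUP_least)
  fix d n m :: nat and \<theta>\<^sub>0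
  assume d: "2 \<le> d" and n: "2 \<le> n" "n = m ^ d"
    and \<theta>\<^sub>0: "\<theta>\<^sub>0 \<in> isotonic_cone d m \<inter> sup_norm_unit_ball d m"
  have m: "2 \<le> m"
  proof (rule ccontr)
    assume "\<not> 2 \<le> m"
    then have "m = 0 \<or> m = 1" by auto
    then show False using n d by (auto simp: power_0_left)
  qed
  define x where "x = ln (real n)"
  have "m\<^sup>2 \<le> m ^ d" using m d by (intro power_increasing) auto
  then have "real (m\<^sup>2) \<le> real n" unfolding n(2) by (rule of_nat_mono)
  then have sq: "(real m)\<^sup>2 \<le> real n" by simp
  \<comment> \<open>As \<open>d \<ge> 2\<close>, \<open>ln n\<close> dominates \<open>2 * ln m\<close>; in particular it is at least \<open>1\<close>, so that higher powers
      of it are larger.\<close>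
  have x_m: "2 * ln (real m) \<le> x"
  proof -
    have "2 * ln (real m) = ln ((real m)\<^sup>2)" by (simp add: ln_realpow)
    also have "\<dots> \<le> x" unfolding x_def using sq m by (intro ln_mono) auto
    finally show ?thesis .
  qed
  have ln2: "2 / 3 \<le> ln (2::real)" by (rule ln2_ge_two_thirds)
  have lnm: "ln 2 \<le> ln (real m)" using m by (intro ln_mono) auto
  have x1: "1 \<le> x" using x_m ln2 lnm by linarith
  obtain K :: nat where K: "m \<le> 2 ^ K" "2 ^ K \<le> 2 * m"
  proof -
    define K where "K = (LEAST k. m \<le> 2 ^ k)"
    have K: "m \<le> 2 ^ K" unfolding K_def by (rule LeastI[of _ m]) (simp add: less_imp_le)
    have "K \<noteq> 0" using K m by (intro notI) simp
    then obtain k where k: "K = Suc k" by (cases K) auto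
    then have "\<not> m \<le> 2 ^ k" using not_less_Least[of k "\<lambda>k. m \<le> 2 ^ k"] by (simp add: K_def)
    then show ?thesis using K k by (intro that[of K]) auto
  qed
  have "real (2 ^ K) \<le> real (2 * m)" using K(2) by (rule of_nat_mono)
  then have K2: "(2::real) ^ K \<le> 2 * real m" by simp
  have K_x: "real K + 1 \<le> 5 * x"
  proof -
    have "real K * ln 2 = ln (2 ^ K)" by (simp add: ln_realpow)
    also have "\<dots> \<le> ln (2 * real m)"
      using K2 m by (intro ln_mono) auto
    also have "\<dots> = ln 2 + ln (real m)" using m by (simp add: ln_mult)
    also have "\<dots> \<le> x" using lnm x_m by linarith
    finally have "real K * ln 2 \<le> x" .
    moreover have "real K * (2 / 3) \<le> real K * ln 2" by (intro mult_left_mono ln2) simp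
    ultimately show ?thesis using x1 by linarith
  qed
  have "ln (2 * real (m ^ d)) = ln 2 + x"
    using n unfolding x_def n(2)[symmetric] by (simp add: ln_mult)
  then have "8 * ln (2 * real (m ^ d)) + 16 \<le> 36 * x"
    using ln_2_less_1 x1 by linarith
  also have "\<dots> \<le> 36 * x * x" using x1 by simp
  also have "\<dots> = (6 * x)\<^sup>2" by (simp add: power2_eq_square)
  finally have \<alpha>: "8 * ln (2 * real (m ^ d)) + 16 \<le> (6 * x)\<^sup>2" .
  have "risk d m (lse d m) \<theta>\<^sub>0 \<le> ennreal (24 * (6 * x) * 2 ^ K * (real K + 1)\<^sup>2 / (real m)\<^sup>2)"
    using d m K(1) \<theta>\<^sub>0 \<alpha> x1 by (intro risk_lse_le) auto
  also have "\<dots> \<le> ennreal (7200 * real n powr (- 1 / real d) * x ^ 4)"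
  proof (rule ennreal_leI)
    have "real n powr (- 1 / real d) = (real m powr real d) powr (- 1 / real d)"
      using m by (simp add: n(2) powr_realpow)
    also have "\<dots> = 1 / real m"
      using m d by (simp add: powr_powr powr_minus divide_simps)
    \<comment> \<open>The dimension disappears from the rate, and survives only in \<open>ln n = d * ln m\<close>.\<close>
    finally have pw: "real n powr (- 1 / real d) = 1 / real m" .
    have "(real K + 1)\<^sup>2 \<le> (5 * x)\<^sup>2" using K_x by (intro power_mono) auto
    then have "24 * (6 * x) * 2 ^ K * (real K + 1)\<^sup>2 / (real m)\<^sup>2
        \<le> 24 * (6 * x) * (2 * real m) * (5 * x)\<^sup>2 / (real m)\<^sup>2"
      using x1 K2 by (intro divide_right_mono mult_mono) auto
    also have "\<dots> = 7200 * (1 / real m) * x ^ 3"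
      using m by (simp add: power2_eq_square power3_eq_cube field_simps)
    also have "\<dots> \<le> 7200 * (1 / real m) * x ^ 4"
      using x1 by (intro mult_left_mono power_increasing) auto
    finally show "24 * (6 * x) * 2 ^ K * (real K + 1)\<^sup>2 / (real m)\<^sup>2
        \<le> 7200 * real n powr (- 1 / real d) * x ^ 4"
      by (simp only: pw)
  qed
  finally show "risk d m (lse d m) \<theta>\<^sub>0 \<le> ennreal (7200 * real n powr (- 1 / real d) * ln (real n) ^ 4)"
    by (simp only: x_def)
qed simp

end
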